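(* Let $L\ge1$ and $0\le n<L$, let $\beta_1,\dots,\beta_L$ be distinct nonzero complex numbers not on $\mathbb T$, and let $\Phi_n,\Phi^*_n,\Xi_n,\Xi^*_n$ be the bi-orthogonal system of the weight $\widehat w(z)=w(z)/\prod_{j=1}^L(z-\beta_j)$. Then there are constants $C,C^*$ independent of $z$ such that $$\Phi_n(z)=C\det\begin{pmatrix}0&\cdots&0&z^n\phi_0(z)&\cdots&\phi_n(z)\\ \beta_1^{L-n-1}&\cdots&1&\xi_0(\beta_1)&\cdots&\beta_1^{-n}\xi_n(\beta_1)\\ \vdots&&\vdots&\vdots&&\vdots\\ \beta_L^{L-n-1}&\cdots&1&\xi_0(\beta_L)&\cdots&\beta_L^{-n}\xi_n(\beta_L)\end{pmatrix},$$ $$\Phi^*_n(z)=C^*\det\begin{pmatrix}0&\cdots&0&z^n\phi^*_0(z)&\cdots&\phi^*_n(z)\\ \beta_1^{L-n}&\cdots&\beta_1&\xi^*_0(\beta_1)&\cdots&\beta_1^{-n}\xi^*_n(\beta_1)\\ \vdots&&\vdots&\vdots&&\vdots\\ \beta_L^{L-n}&\cdots&\beta_L&\xi^*_0(\beta_L)&\cdots&\beta_L^{-n}\xi^*_n(\beta_L)\end{pmatrix},$$ $$\prod_{j=1}^L(z-\beta_j)\,\Xi_n(z)=C\det\begin{pmatrix}z^{L-1}&\cdots&z^n&z^n\xi_0(z)&\cdots&\xi_n(z)\\ \beta_1^{L-n-1}&\cdots&1&\xi_0(\beta_1)&\cdots&\beta_1^{-n}\xi_n(\beta_1)\\ \vdots&&\vdots&\vdots&&\vdots\\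 \beta_L^{L-n-1}&\cdots&1&\xi_0(\beta_L)&\cdots&\beta_L^{-n}\xi_n(\beta_L)\end{pmatrix},$$ $$\prod_{j=1}^L(z-\beta_j)\,\Xi^*_n(z)=C^*\det\begin{pmatrix}z^{L}&\cdots&z^{n+1}&z^n\xi^*_0(z)&\cdots&\xi^*_n(z)\\ \beta_1^{L-n}&\cdots&\beta_1&\xi^*_0(\beta_1)&\cdots&\beta_1^{-n}\xi^*_n(\beta_1)\\ \vdots&&\vdots&\vdots&&\vdots\\ \beta_L^{L-n}&\cdots&\beta_L&\xi^*_0(\beta_L)&\cdots&\beta_L^{-n}\xi^*_n(\beta_L)\end{pmatrix}.$$ In each matrix the first $L-n$ columns carry consecutive decreasing powers, and the last $n+1$ columns are indexed by $m=0,\dots,n$, with top entries $z^{n-m}\phi_m(z)$, $z^{n-m}\phi^*_m(z)$, $z^{n-m}\xi_m(z)$, $z^{n-m}\xi^*_m(z)$ respectively and lower entries $\beta_r^{-m}\xi_m(\beta_r)$ or $\beta_r^{-m}\xi^*_m(\beta_r)$.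
   Context: $\mathbb T$ is the unit circle. For a complex-valued weight $w$ on $\mathbb T$ put $w_k=\int_{\mathbb T}\frac{d\zeta}{2\pi i\zeta}w(\zeta)\zeta^{-k}$ and $I_n[w]=\det[w_{j-k}]_{j,k=0,\dots,n-1}$, $I_0=1$. If $I_n[w]\ne0$ for all $n\ge0$, the bi-orthogonal system of $w$ is: polynomials $\phi_n,\bar\phi_n$ of degree $n$ with the same leading coefficient $\kappa_n$ satisfying $\int_{\mathbb T}\frac{d\zeta}{2\pi i\zeta}w(\zeta)\phi_m(\zeta)\bar\phi_n(\bar\zeta)=\delta_{m,n}$ with $\bar\zeta=1/\zeta$ ($\bar\phi_n$ is a separate polynomial, not in general the complex conjugate of $\phi_n$; $\kappa_n^2=I_n/I_{n+1}$, with a choice of square root $\kappa_n$ fixed); the reciprocal polynomial $\phi^*_n(z)=z^n\bar\phi_n(1/z)$; and the associated functions, for $z\notin\mathbb T$ and $n>0$, $\xi_n(z)=\int_{\mathbb T}\frac{d\zeta}{2\pi i\zeta}\frac{\zeta+z}{\zeta-z}w(\zeta)\phi_n(\zeta)$, $\ \xi^*_n(z)=-z^n\int_{\mathbb T}\frac{d\zeta}{2\pi i\zeta}\frac{\zeta+z}{\zeta-z}w(\zeta)\bar\phi_n(\bar\zeta)=\frac1{\kappa_n}-\int_{\mathbb T}\frac{d\zeta}{2\pi i\zeta}\frac{\zeta+z}{\zeta-z}w(\zeta)\phi^*_n(\zeta)$, and $\xi_0(z)=\kappa_0[w_0+F(z)]$, $\xi^*_0(z)=\kappa_0[w_0-F(z)]$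 with $F(z)=\int_{\mathbb T}\frac{d\zeta}{2\pi i\zeta}\frac{\zeta+z}{\zeta-z}w(\zeta)$. Set $r_n=\phi_n(0)/\kappa_n$, $\bar r_n=\bar\phi_n(0)/\kappa_n$. The same definitions and normalisation applied to a modified weight $\widehat w$ give $\Phi_n,\bar\Phi_n,\Phi^*_n,\Xi_n,\Xi^*_n$, leading coefficient $\widehat\kappa_n$, and $\widehat r_n,\widehat{\bar r}_n$. Standing generic assumptions: both the original and the modified bi-orthogonal systems exist, and $r_n\bar r_n\ne0,1$, $\widehat r_n\widehat{\bar r}_n\ne0,1$ for all $n\ge1$. *)

theory Defs
  imports "HOL-Complex_Analysis.Complex_Analysis" "Jordan_Normal_Form.Determinant"
begin

definition circle_int :: "(complex \<Rightarrow> complex) \<Rightarrow> complex" where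
  "circle_int f = contour_integral (circlepath 0 1) (\<lambda>\<zeta>. f \<zeta> / (2 * of_real pi * \<i> * \<zeta>))"

text \<open>A weight is a complex function in $L^1$ of the unit circle; its values elsewhere are irrelevant.
  Lebesgue (rather than merely gauge) integrability makes the products of the weight with
  continuous functions that occur below integrable.\<close>

definition circle_weight :: "(complex \<Rightarrow> complex) \<Rightarrow> bool" where
  "circle_weight w \<longleftrightarrow> (\<lambda>t. w (circlepath 0 1 t)) absolutely_integrable_on {0..1}"

definition fourier_coeff :: "(complex \<Rightarrow> complex) \<Rightarrow> int \<Rightarrow> complex" where
  "fourier_coeff w k = circle_int (\<lambda>\<zeta>. w \<zeta> * \<zeta> powi (- k))"

definition toeplitz_det :: "(complex \<Rightarrow> complex) \<Rightarrow> nat \<Rightarrow> complex" where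
  "toeplitz_det w n = Determinant.det (mat n n (\<lambda>(j, k). fourier_coeff w (int j - int k)))"

lemma toeplitz_det_0: "toeplitz_det w 0 = 1"
  by (simp add: toeplitz_det_def)

text \<open>The second family \<open>\<psi>\<close> is the one usually written $\bar\phi$; it is not the complex
  conjugate of \<open>\<phi>\<close>. On the circle $\bar\zeta = 1/\zeta$. The common leading coefficient
  $\kappa_n$ is \<open>lead_coeff (\<phi> n)\<close>; orthonormality determines $\kappa_n^2$, and the predicate
  holds for every choice of the square roots.\<close>

definition biorthogonal_system ::
  "(complex \<Rightarrow> complex) \<Rightarrow> (nat \<Rightarrow> complex poly) \<Rightarrow> (nat \<Rightarrow> complex poly) \<Rightarrow> bool" where
  "biorthogonal_system w \<phi> \<psi> \<longleftrightarrow>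
     (\<forall>n. toeplitz_det w n \<noteq> 0) \<and>
     (\<forall>n. degree (\<phi> n) = n \<and> degree (\<psi> n) = n \<and> lead_coeff (\<phi> n) = lead_coeff (\<psi> n)) \<and>
     (\<forall>m n. circle_int (\<lambda>\<zeta>. w \<zeta> * poly (\<phi> m) \<zeta> * poly (\<psi> n) (1 / \<zeta>)) = (if m = n then 1 else 0))"

definition reflection_coeff :: "(nat \<Rightarrow> complex poly) \<Rightarrow> nat \<Rightarrow> complex" where
  "reflection_coeff \<phi> n = poly (\<phi> n) 0 / lead_coeff (\<phi> n)"

definition generic_system :: "(nat \<Rightarrow> complex poly) \<Rightarrow> (nat \<Rightarrow> complex poly) \<Rightarrow> bool" where
  "generic_system \<phi> \<psi> \<longleftrightarrow>
     (\<forall>n\<ge>1. reflection_coeff \<phi> n * reflection_coeff \<psi> n \<noteq> 0 \<and>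
             reflection_coeff \<phi> n * reflection_coeff \<psi> n \<noteq> 1)"

text \<open>The reciprocal polynomial as a genuine polynomial: the pointwise expression
  $z^n\psi_n(1/z)$ would take a wrong value at $z = 0$ because of \<open>1 / 0 = 0\<close>.\<close>

definition recip :: "(nat \<Rightarrow> complex poly) \<Rightarrow> nat \<Rightarrow> complex poly" where
  "recip \<psi> n = reflect_poly (\<psi> n)"

lemma poly_recip:
  assumes "degree (\<psi> n) = n" and "z \<noteq> 0"
  shows "poly (recip \<psi> n) z = z ^ n * poly (\<psi> n) (1 / z)"
  using assms by (simp add: recip_def poly_reflect_poly_nz inverse_eq_divide)

definition caratheodory_fun :: "(complex \<Rightarrow> complex) \<Rightarrow> complex \<Rightarrow> complex" where
  "caratheodory_fun w z = circle_int (\<lambda>\<zeta>. (\<zeta> + z) / (\<zeta> - z) * w \<zeta>)"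

definition assoc_fun ::
  "(complex \<Rightarrow> complex) \<Rightarrow> (nat \<Rightarrow> complex poly) \<Rightarrow> nat \<Rightarrow> complex \<Rightarrow> complex" where
  "assoc_fun w \<phi> n z =
     (if n = 0 then lead_coeff (\<phi> 0) * (fourier_coeff w 0 + caratheodory_fun w z)
      else circle_int (\<lambda>\<zeta>. (\<zeta> + z) / (\<zeta> - z) * w \<zeta> * poly (\<phi> n) \<zeta>))"

text \<open>In a bi-orthogonal system \<open>lead_coeff (\<psi> 0)\<close> is $\kappa_0$.\<close>

definition assoc_fun_star ::
  "(complex \<Rightarrow> complex) \<Rightarrow> (nat \<Rightarrow> complex poly) \<Rightarrow> nat \<Rightarrow> complex \<Rightarrow> complex" where
  "assoc_fun_star w \<psi> n z =
     (if n = 0 then lead_coeff (\<psi> 0) * (fourier_coeff w 0 - caratheodory_fun w z)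
      else - (z ^ n) * circle_int (\<lambda>\<zeta>. (\<zeta> + z) / (\<zeta> - z) * w \<zeta> * poly (\<psi> n) (1 / \<zeta>)))"

definition modified_weight ::
  "(complex \<Rightarrow> complex) \<Rightarrow> nat \<Rightarrow> (nat \<Rightarrow> complex) \<Rightarrow> complex \<Rightarrow> complex" where
  "modified_weight w L \<beta> z = w z / (\<Prod>j=1..L. z - \<beta> j)"

text \<open>The determinant of order \<open>L + 1\<close> with top row \<open>(p 0, \<dots>, p (L - n - 1), f 0, \<dots>, f n)\<close> and
  rows \<open>(q r 0, \<dots>, q r (L - n - 1), g r 0, \<dots>, g r n)\<close> for \<open>r = 1, \<dots>, L\<close>.\<close>

definition bordered_det ::
  "nat \<Rightarrow> nat \<Rightarrow> (nat \<Rightarrow> complex) \<Rightarrow> (nat \<Rightarrow> complex) \<Rightarrow>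
   (nat \<Rightarrow> nat \<Rightarrow> complex) \<Rightarrow> (nat \<Rightarrow> nat \<Rightarrow> complex) \<Rightarrow> complex" where
  "bordered_det L n p f q g = Determinant.det (mat (L + 1) (L + 1) (\<lambda>(r, c).
     if r = 0 then (if c < L - n then p c else f (c - (L - n)))
     else (if c < L - n then q r c else g r (c - (L - n)))))"

end

theory Submission
  imports Defs
begin

text \<open>
  Write $S[f](z) = \int_{\mathbb T} \frac{d\zeta}{2\pi i\zeta} \frac{f(\zeta)}{\zeta - z}$ and
  $P(z) = \prod_j (z - \beta_j)$. Orthogonality gives
  $\xi_m(z) = z^m S[2 \zeta^{1-m} w \phi_m](z)$ and
  $\xi^*_m(z) = - z^{m+1} S[2 w \bar\phi_m(1/\zeta)](z)$. Let $(b, a)$ be the vector of cofactors of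
  the top row of the bordered determinant. It is orthogonal to the rows of the $\beta_r$, which says
  that $B + S[w u]$ vanishes at every $\beta_r$, where $B(z) = \sum_j b_j z^{L-n-1-j}$ and $u$ is a
  combination, with coefficients $a_m$, of the functions $\zeta^{1-m}\phi_m$ (respectively
  $\bar\phi_m(1/\zeta)$). Since $B + S[w u] - P\, S[\widehat w u]$ is a polynomial of degree less than
  $L$, it is zero; comparing its coefficients of $z^{L-1}, \dots, z^{L-n}$ yields
  $\int \widehat w u \zeta^k = 0$ for $k < n$. This orthogonality identifies
  $\sum_m a_m z^{n-m} \phi_m$ with a multiple $c\, \Phi_n$. The same argument shows that no nonzero
  vector orthogonal to the lower rows is annihilated by the leading-coefficient functional, so
  $c \neq 0$, and $C = 1/c$.
\<close>

section \<open>Integration on the circle\<close>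

text \<open>On the unit circle the velocity of the path is \<open>2 * pi * \<i> * \<zeta>\<close>,
  which cancels the normalising denominator. So \<open>circle_int\<close> is a plain integral over
  the parameter, and linearity is inherited from there.\<close>

lemma circle_int_eq: "circle_int f = integral {0..1} (\<lambda>t. f (circlepath 0 1 t))"
proof -
  have ne: "circlepath 0 1 t \<noteq> 0" for t by (simp add: circlepath)
  show ?thesis
    unfolding circle_int_def contour_integral_integral
    using ne by (intro integral_cong) (simp add: vector_derivative_circlepath, simp add: circlepath)
qed

lemma circlepath_unit_in_sphere: "circlepath 0 1 t \<in> sphere 0 1"
  by (simp add: circlepath norm_mult)

lemma circle_int_cong:
  assumes "\<And>\<zeta>. \<zeta> \<in> sphere 0 1 \<Longrightarrow> f \<zeta> = g \<zeta>"
  shows "circle_int f = circle_int g"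
  unfolding circle_int_eq using assms circlepath_unit_in_sphere by simp

text \<open>A continuous factor is bounded and measurable on the compact circle, so it preserves
  absolute integrability. This settles most integrability conditions below.\<close>

lemma circle_weight_mult:
  assumes "circle_weight w" and "continuous_on (sphere 0 1) g"
  shows "circle_weight (\<lambda>\<zeta>. w \<zeta> * g \<zeta>)"
proof -
  have "continuous_on {0..1} (\<lambda>t. g (circlepath 0 1 t))"
    by (rule continuous_on_compose2[OF assms(2)])
       (auto simp: circlepath norm_mult intro!: continuous_intros)
  then show ?thesis
    using absolutely_integrable_bounded_measurable_product[OF bilinear_times,
        of "\<lambda>t. g (circlepath 0 1 t)" "{0..1}" "\<lambda>t. w (circlepath 0 1 t)"] assms(1)
      continuous_imp_measurable_on_sets_lebesgue[of "{0..1}" "\<lambda>t. g (circlepath 0 1 t)"]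
      compact_imp_bounded[OF compact_continuous_image[of "{0..1}" "\<lambda>t. g (circlepath 0 1 t)"]]
    by (simp add: circle_weight_def mult.commute)
qed

lemma circle_weightI:
  assumes "circle_weight w" and "continuous_on (sphere 0 1) g"
    and "\<And>\<zeta>. \<zeta> \<in> sphere 0 1 \<Longrightarrow> f \<zeta> = w \<zeta> * g \<zeta>"
  shows "circle_weight f"
  using circle_weight_mult[OF assms(1,2)] assms(3) circlepath_unit_in_sphere
  by (simp add: circle_weight_def)

lemma circle_int_add:
  assumes "circle_weight f" and "circle_weight g"
  shows "circle_int (\<lambda>\<zeta>. f \<zeta> + g \<zeta>) = circle_int f + circle_int g"
  using assms unfolding circle_int_eq circle_weight_def
  by (intro integral_add) (auto intro: set_lebesgue_integral_eq_integral(1))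

text \<open>Valid for every \<open>f\<close>: a non-integrable function has integral 0 by
  convention, and a nonzero factor cannot make it integrable.\<close>

lemma circle_int_cmult: "circle_int (\<lambda>\<zeta>. c * f \<zeta>) = c * circle_int f"
  by (simp add: circle_int_eq)

lemma circle_int_sum:
  assumes "finite I" and "\<And>i. i \<in> I \<Longrightarrow> circle_weight (f i)"
  shows "circle_int (\<lambda>\<zeta>. \<Sum>i\<in>I. f i \<zeta>) = (\<Sum>i\<in>I. circle_int (f i))"
  using assms unfolding circle_int_eq circle_weight_def
  by (intro integral_sum) (auto intro: set_lebesgue_integral_eq_integral(1))

section \<open>Modified weights and Cauchy transforms on the circle\<close>

lemma modified_weight_eq:
  "modified_weight w L \<beta> = (\<lambda>\<zeta>. w \<zeta> * inverse (\<Prod>j=1..L. \<zeta> - \<beta> j))"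
  by (simp add: modified_weight_def fun_eq_iff divide_inverse)

lemma circle_weight_modified:
  assumes "circle_weight w" and "\<And>j. j \<in> {1..L} \<Longrightarrow> \<beta> j \<notin> sphere 0 1"
  shows "circle_weight (modified_weight w L \<beta>)"
  unfolding modified_weight_eq using assms
  by (intro circle_weight_mult continuous_intros) auto

text \<open>The measure inside \<open>circle_int\<close> contributes \<open>1 / \<zeta>\<close>, so
  this is the classical Cauchy integral of \<open>f \<zeta> / \<zeta>\<close>.\<close>

definition cauchy_transform :: "(complex \<Rightarrow> complex) \<Rightarrow> complex \<Rightarrow> complex" where
  "cauchy_transform f z = circle_int (\<lambda>\<zeta>. f \<zeta> / (\<zeta> - z))"

lemma circle_weight_cauchy:
  assumes "circle_weight f" and "z \<notin> sphere 0 1"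
  shows "circle_weight (\<lambda>\<zeta>. f \<zeta> / (\<zeta> - z))"
  unfolding divide_inverse using assms
  by (intro circle_weight_mult continuous_intros) auto

lemma cauchy_transform_sum:
  assumes "finite I" and "\<And>i. i \<in> I \<Longrightarrow> circle_weight (f i)" and "z \<notin> sphere 0 1"
  shows "cauchy_transform (\<lambda>\<zeta>. \<Sum>i\<in>I. a i * f i \<zeta>) z = (\<Sum>i\<in>I. a i * cauchy_transform (f i) z)"
proof -
  have "circle_weight (\<lambda>\<zeta>. a i * (f i \<zeta> / (\<zeta> - z)))" if "i \<in> I" for i
    using circle_weight_mult[OF circle_weight_cauchy[OF assms(2)[OF that] assms(3)], of "\<lambda>_. a i"]
    by (simp add: mult.commute)
  then have "circle_int (\<lambda>\<zeta>. \<Sum>i\<in>I. a i * (f i \<zeta> / (\<zeta> - z)))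
      = (\<Sum>i\<in>I. circle_int (\<lambda>\<zeta>. a i * (f i \<zeta> / (\<zeta> - z))))"
    by (intro circle_int_sum assms(1))
  then show ?thesis
    unfolding circle_int_cmult cauchy_transform_def
    by (simp add: sum_divide_distrib)
qed

lemma cauchy_transform_cmult: "cauchy_transform (\<lambda>\<zeta>. c * f \<zeta>) z = c * cauchy_transform f z"
  using circle_int_cmult[of c "\<lambda>\<zeta>. f \<zeta> / (\<zeta> - z)"] by (simp add: cauchy_transform_def)

lemma cauchy_transform_cong:
  assumes "\<And>\<zeta>. \<zeta> \<in> sphere 0 1 \<Longrightarrow> f \<zeta> = g \<zeta>"
  shows "cauchy_transform f z = cauchy_transform g z"
  unfolding cauchy_transform_def using assms by (intro circle_int_cong) simp

section \<open>Linear algebra\<close>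

lemma mat_kernel_trivial:
  fixes A :: "nat \<Rightarrow> nat \<Rightarrow> complex"
  assumes "Determinant.det (mat n n (\<lambda>(j, k). A j k)) \<noteq> 0"
    and "\<And>k. k < n \<Longrightarrow> (\<Sum>i<n. A k i * c i) = 0" and "i < n"
  shows "c i = 0"
proof -
  have "mat n n (\<lambda>(j, k). A j k) *\<^sub>v vec n c = 0\<^sub>v n"
    using assms(2) by (intro eq_vecI) (auto simp: scalar_prod_def atLeast0LessThan)
  then have "vec n c = 0\<^sub>v n"
    using assms(1) det_0_iff_vec_prod_zero[OF mat_carrier, of n "\<lambda>(j, k). A j k"] vec_carrier
    by blast
  then show ?thesis
    using assms(3) by (metis index_vec index_zero_vec(1))
qed

section \<open>Expansion of the bordered determinant along its top row\<close>

lemma sum_lessThan_add_Suc: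
  fixes F :: "nat \<Rightarrow> 'a::comm_monoid_add"
  shows "(\<Sum>c<k + Suc n. F c) = (\<Sum>c<k. F c) + (\<Sum>m\<le>n. F (k + m))"
  by (induction n) (simp_all add: add_ac)

text \<open>\<open>b\<close> and \<open>a\<close> are the cofactors of the top row, hence
  independent of \<open>p\<close> and \<open>f\<close>. A top row that repeats a lower row gives
  determinant 0, which is the second claim. The third says that the matrix with top row
  \<open>(0, t)\<close> is nonsingular, which is what \<open>trivial\<close> ensures.\<close>

lemma bordered_det_expansion:
  assumes "n < L"
    and trivial: "\<And>b a. \<lbrakk>\<And>r. r \<in> {1..L} \<Longrightarrow> (\<Sum>j<L - n. q r j * b j) + (\<Sum>m\<le>n. g r m * a m) = 0;
        (\<Sum>m\<le>n. t m * a m) = 0\<rbrakk> \<Longrightarrow> (\<forall>j<L - n. b j = 0) \<and> (\<forall>m\<le>n. a m = 0)"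
  obtains b a where
    "\<And>p f. bordered_det L n p f q g = (\<Sum>j<L - n. p j * b j) + (\<Sum>m\<le>n. f m * a m)"
    and "\<And>r. r \<in> {1..L} \<Longrightarrow> (\<Sum>j<L - n. q r j * b j) + (\<Sum>m\<le>n. g r m * a m) = 0"
    and "(\<Sum>m\<le>n. t m * a m) \<noteq> 0"
proof -
  define E where "E p f r c = (if r = 0 then (if c < L - n then p c else f (c - (L - n)))
     else (if c < L - n then q r c else g r (c - (L - n))))" for p f :: "nat \<Rightarrow> complex" and r c :: nat
  define A where "A p f = mat (L + 1) (L + 1) (\<lambda>(r, c). E p f r c)" for p f
  have carrier: "A p f \<in> carrier_mat (L + 1) (L + 1)" for p f
    by (simp add: A_def)
  have det: "bordered_det L n p f q g = Determinant.det (A p f)" for p f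
    by (simp add: bordered_det_def A_def E_def)
  have entry: "A p f $$ (r, c) = E p f r c" if "r < L + 1" "c < L + 1" for p f r c
    using that by (simp add: A_def)
  have zero_less: "0 < L + 1" by simp
  have L: "L + 1 = (L - n) + Suc n" using assms(1) by simp
  \<comment> \<open>Deleting row 0 erases \<open>p\<close> and \<open>f\<close>, so any top row
    serves; zeros are taken.\<close>
  define cof where "cof c = cofactor (A (\<lambda>_. 0) (\<lambda>_. 0)) 0 c" for c
  have cof: "cofactor (A p f) 0 c = cof c" if "c < L + 1" for p f c
    using that unfolding cof_def cofactor_def
    by (intro arg_cong2[where f="(*)"] arg_cong[where f=Determinant.det])
      (auto simp: mat_delete_def A_def E_def mat_eq_iff)
  define b where "b = cof"
  define a where "a m = cof (L - n + m)" for m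
  have split_row: "(\<Sum>c<L + 1. E p f r c * h c) = (\<Sum>j<L - n. E p f r j * h j)
      + (\<Sum>m\<le>n. E p f r (L - n + m) * h (L - n + m))" for p f r h
    unfolding L by (rule sum_lessThan_add_Suc)
  have expansion: "bordered_det L n p f q g = (\<Sum>j<L - n. p j * b j) + (\<Sum>m\<le>n. f m * a m)" for p f
  proof -
    have "bordered_det L n p f q g = (\<Sum>c<L + 1. E p f 0 c * cof c)"
      unfolding det laplace_expansion_row[OF carrier zero_less]
      by (intro sum.cong) (simp_all add: cof entry)
    then show ?thesis
      by (simp only: split_row) (simp add: E_def a_def b_def)
  qed
  have kernel: "(\<Sum>j<L - n. q r j * b j) + (\<Sum>m\<le>n. g r m * a m) = 0" if "r \<in> {1..L}" for r
  proof -
    have "Determinant.det (A (q r) (g r)) = 0"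
      by (rule Determinant.det_identical_rows[OF carrier, of 0 r])
        (use that in \<open>auto simp: A_def E_def\<close>)
    then show ?thesis using expansion[of "q r" "g r"] by (simp add: det)
  qed
  have "(\<Sum>m\<le>n. t m * a m) \<noteq> 0"
  proof
    assume "(\<Sum>m\<le>n. t m * a m) = 0"
    then have "Determinant.det (A (\<lambda>_. 0) t) = 0"
      using expansion[of "\<lambda>_. 0" t] by (simp add: det)
    \<comment> \<open>\<open>trivial\<close> is applied to a nonzero kernel vector instead of the
      cofactors, because vanishing cofactors would not yet be a contradiction.\<close>
    then obtain v where v: "v \<in> carrier_vec (L + 1)" "v \<noteq> 0\<^sub>v (L + 1)"
        "A (\<lambda>_. 0) t *\<^sub>v v = 0\<^sub>v (L + 1)"
      using det_0_iff_vec_prod_zero[OF carrier] by blast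
    have rows: "(\<Sum>j<L - n. E (\<lambda>_. 0) t r j * v $ j)
        + (\<Sum>m\<le>n. E (\<lambda>_. 0) t r (L - n + m) * v $ (L - n + m)) = 0" if "r < L + 1" for r
    proof -
      have "(A (\<lambda>_. 0) t *\<^sub>v v) $ r = (\<Sum>c<L + 1. E (\<lambda>_. 0) t r c * v $ c)"
        using that v(1) by (auto simp: A_def scalar_prod_def atLeast0LessThan)
      then show ?thesis
        using that v(3) by (simp only: split_row) simp
    qed
    have "(\<forall>j<L - n. v $ j = 0) \<and> (\<forall>m\<le>n. v $ (L - n + m) = 0)"
    proof (rule trivial)
      show "(\<Sum>j<L - n. q r j * v $ j) + (\<Sum>m\<le>n. g r m * v $ (L - n + m)) = 0"
        if "r \<in> {1..L}" for r
        using that rows[of r] by (simp add: E_def)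
      show "(\<Sum>m\<le>n. t m * v $ (L - n + m)) = 0"
        using rows[of 0] by (simp add: E_def)
    qed
    then have "v $ c = 0" if "c < L + 1" for c
      using that by (cases "c < L - n") (auto dest!: spec[of _ "c - (L - n)"])
    then have "v = 0\<^sub>v (L + 1)"
      using v(1) by (intro eq_vecI) auto
    with v(2) show False ..
  qed
  with expansion kernel show thesis by (rule that)
qed

text \<open>Back substitution from \<open>i = n\<close> downwards: equation \<open>i\<close>
  involves only the unknowns \<open>a m\<close> with \<open>m \<ge> i\<close>, and those with
  \<open>m > i\<close> are already known to vanish.\<close>

lemma triangular_sum_eq_0:
  fixes C :: "nat \<Rightarrow> nat \<Rightarrow> complex"
  assumes lower: "\<And>m i. m < i \<Longrightarrow> C m i = 0" and diag: "\<And>i. C i i \<noteq> 0"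
    and sum: "\<And>i. i \<le> n \<Longrightarrow> (\<Sum>m\<le>n. a m * C m i) = 0" and "i \<le> n"
  shows "a i = 0"
  using \<open>i \<le> n\<close>
proof (induction "n - i" arbitrary: i rule: less_induct)
  case less
  have "a m * C m i = (if m = i then a i * C i i else 0)" if "m \<le> n" for m
    using less.hyps[of m] less.prems lower[of m i] that by (cases m i rule: linorder_cases) auto
  then have "(\<Sum>m\<le>n. a m * C m i) = (\<Sum>m\<le>n. if m = i then a i * C i i else 0)"
    by (intro sum.cong) auto
  then show ?case
    using sum[OF less.prems] diag[of i] less.prems by simp
qed

text \<open>The polynomials \<open>\<rho> 0, ..., \<rho> (n - 1)\<close> have exact degrees and so
  span the polynomials of degree below \<open>n\<close>. Bounding coefficients instead of
  \<open>degree\<close> makes the case \<open>n = 0\<close> mean \<open>q = 0\<close>.\<close>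

lemma linear_functional_expansion:
  fixes \<Lambda> :: "complex poly \<Rightarrow> complex"
  assumes add: "\<And>p q. \<Lambda> (p + q) = \<Lambda> p + \<Lambda> q" and smult: "\<And>c p. \<Lambda> (Polynomial.smult c p) = c * \<Lambda> p"
    and "\<And>k. coeff (\<rho> k) k \<noteq> 0" and "\<And>k i. k < i \<Longrightarrow> coeff (\<rho> k) i = 0"
    and "\<And>k. k < n \<Longrightarrow> \<Lambda> (\<rho> k) = 0" and "\<And>i. n \<le> i \<Longrightarrow> coeff q i = 0"
  shows "\<Lambda> q = 0"
  using assms(5,6)
proof (induction n arbitrary: q)
  case 0
  \<comment> \<open>Writing 0 as a multiple of itself lets homogeneity yield
    \<open>\<Lambda> 0 = 0\<close>.\<close>
  then have "q = Polynomial.smult 0 0" by (simp add: poly_eq_iff)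
  then show ?case using smult[of 0 0] by simp
next
  case (Suc n)
  define c where "c = coeff q n / coeff (\<rho> n) n"
  have coeff: "coeff (q + Polynomial.smult (- c) (\<rho> n)) i = 0" if "n \<le> i" for i
    using that Suc.prems(2)[of i] assms(3)[of n] assms(4)[of n i]
    by (cases "i = n") (auto simp: c_def)
  have "\<Lambda> (q + Polynomial.smult (- c) (\<rho> n)) = 0"
    by (rule Suc.IH[OF _ coeff]) (simp_all add: Suc.prems(1))
  then show ?case
    using Suc.prems(1)[of n] unfolding add smult by simp
qed

text \<open>Cancelling the coefficient of degree \<open>n\<close> by a multiple of
  \<open>\<rho>\<close> leaves a polynomial whose coefficient vector lies in the kernel of the
  moment matrix. Abstract functionals allow evaluation at \<open>\<zeta>\<close> for one family and
  at \<open>1 / \<zeta>\<close> for the other.\<close>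

lemma eq_smult_if_annihilated:
  fixes \<Lambda> :: "nat \<Rightarrow> complex poly \<Rightarrow> complex"
  assumes add: "\<And>k p q. \<Lambda> k (p + q) = \<Lambda> k p + \<Lambda> k q" and smult: "\<And>k c p. \<Lambda> k (Polynomial.smult c p) = c * \<Lambda> k p"
    and det: "Determinant.det (mat n n (\<lambda>(k, i). \<Lambda> k (monom 1 i))) \<noteq> 0"
    and \<rho>: "coeff \<rho> n \<noteq> 0" "\<And>i. n < i \<Longrightarrow> coeff \<rho> i = 0" "\<And>k. k < n \<Longrightarrow> \<Lambda> k \<rho> = 0"
    and p: "\<And>i. n < i \<Longrightarrow> coeff p i = 0" "\<And>k. k < n \<Longrightarrow> \<Lambda> k p = 0"
  shows "p = Polynomial.smult (coeff p n / coeff \<rho> n) \<rho>"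
proof -
  define c where "c = coeff p n / coeff \<rho> n"
  define q where "q = p + Polynomial.smult (- c) \<rho>"
  have high: "coeff q i = 0" if "n \<le> i" for i
    using that p(1) \<rho>(1,2) by (cases "i = n") (auto simp: q_def c_def)
  have sum: "\<Lambda> k (\<Sum>i<N. Polynomial.smult (f i) (r i)) = (\<Sum>i<N. f i * \<Lambda> k (r i))" for k f r and N :: nat
    using smult[of k 0 0] by (induction N) (simp_all add: add smult)
  have q: "q = (\<Sum>i<n. Polynomial.smult (coeff q i) (monom 1 i))"
  proof (rule poly_eqI)
    fix j
    have "coeff (\<Sum>i<n. Polynomial.smult (coeff q i) (monom 1 i)) j = (\<Sum>i<n. if i = j then coeff q i else 0)"
      unfolding coeff_sum by (intro sum.cong) auto
    then show "coeff q j = coeff (\<Sum>i<n. Polynomial.smult (coeff q i) (monom 1 i)) j"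
      using high[of j] by auto
  qed
  have "(\<Sum>i<n. \<Lambda> k (monom 1 i) * coeff q i) = 0" if "k < n" for k
  proof -
    have "\<Lambda> k q = 0"
      using p(2)[OF that] \<rho>(3)[OF that] unfolding q_def add smult by simp
    then show ?thesis
      by (subst (asm) q) (simp add: sum mult.commute)
  qed
  then have "coeff q i = 0" for i
    using mat_kernel_trivial[OF det, of "coeff q" i] high[of i] by (cases "i < n") auto
  then have "q = 0"
    by (simp add: poly_eq_iff)
  then show ?thesis
    unfolding c_def[symmetric] by (simp add: q_def)
qed

section \<open>The Cauchy transform of a modified weight\<close>

lemma prod_roots_poly:
  fixes \<beta> :: "nat \<Rightarrow> complex" and L :: nat
  defines "P \<equiv> \<Prod>j=1..L. [:- \<beta> j, 1:]"
  shows "poly P z = (\<Prod>j=1..L. z - \<beta> j)" and "degree P = L" and "coeff P L = 1"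
proof -
  show "poly P z = (\<Prod>j=1..L. z - \<beta> j)"
    by (simp add: P_def poly_prod)
  show deg: "degree P = L"
    unfolding P_def by (subst degree_prod_eq_sum_degree) auto
  show "coeff P L = 1"
    using lead_coeff_prod[of "\<lambda>j. [:- \<beta> j, 1:]" "{1..L}"] deg by (simp add: P_def)
qed

lemma poly_eq_0_if_vanishes_on_image:
  fixes p :: "complex poly" and \<beta> :: "nat \<Rightarrow> complex"
  assumes "degree p < L" and "inj_on \<beta> {1..L}" and "\<And>r. r \<in> {1..L} \<Longrightarrow> poly p (\<beta> r) = 0"
  shows "p = 0"
proof (rule ccontr)
  assume "p \<noteq> 0"
  have "\<beta> ` {1..L} \<subseteq> {x. poly p x = 0}"
    using assms(3) by auto
  with \<open>p \<noteq> 0\<close> have "card (\<beta> ` {1..L}) \<le> card {x. poly p x = 0}"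
    by (intro Finite_Set.card_mono poly_roots_finite)
  also have "\<dots> \<le> degree p"
    using \<open>p \<noteq> 0\<close> by (rule card_poly_roots_bound)
  finally show False
    using assms(1) Finite_Set.card_image[OF assms(2)] by simp
qed

text \<open>On the circle \<open>w\<close> is \<open>poly P\<close> times the modified weight. Since
  \<open>poly P \<zeta>\<close> equals \<open>poly P z\<close> plus \<open>\<zeta> - z\<close> times
  a divided difference, division by \<open>\<zeta> - z\<close> leaves a polynomial in
  \<open>z\<close> of degree below \<open>L\<close> whose coefficients are built from moments of
  \<open>v\<close>.\<close>

lemma cauchy_transform_modified_weight:
  fixes \<beta> :: "nat \<Rightarrow> complex" and w u :: "complex \<Rightarrow> complex" and L :: nat
  defines "P \<equiv> \<Prod>j=1..L. [:- \<beta> j, 1:]" and "v \<equiv> \<lambda>\<zeta>. modified_weight w L \<beta> \<zeta> * u \<zeta>"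
  assumes "circle_weight w" and "continuous_on (sphere 0 1) u"
    and off: "\<And>j. j \<in> {1..L} \<Longrightarrow> \<beta> j \<notin> sphere 0 1" and "z \<notin> sphere 0 1"
  shows "cauchy_transform (\<lambda>\<zeta>. w \<zeta> * u \<zeta>) z = poly P z * cauchy_transform v z
    + (\<Sum>i\<le>L. \<Sum>k<i. coeff P i * circle_int (\<lambda>\<zeta>. v \<zeta> * \<zeta> ^ k) * z ^ (i - Suc k))"
proof -
  have v: "circle_weight v"
    unfolding v_def by (intro circle_weight_mult circle_weight_modified assms)
  have monomial: "circle_weight (\<lambda>\<zeta>. (coeff P i * z ^ (i - Suc k)) * (v \<zeta> * \<zeta> ^ k))" for i k
    using circle_weight_mult[OF v, of "\<lambda>\<zeta>. \<zeta> ^ k * (coeff P i * z ^ (i - Suc k))"]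
    by (simp add: mult_ac continuous_intros)
  have kernel: "circle_weight (\<lambda>\<zeta>. poly P z * (v \<zeta> / (\<zeta> - z)))"
    using circle_weight_mult[OF circle_weight_cauchy[OF v assms(6)], of "\<lambda>_. poly P z"]
    by (simp add: mult_ac)
  have inner: "circle_weight (\<lambda>\<zeta>. \<Sum>k<i. (coeff P i * z ^ (i - Suc k)) * (v \<zeta> * \<zeta> ^ k))" for i
    using circle_weight_mult[OF v, of "\<lambda>\<zeta>. \<Sum>k<i. \<zeta> ^ k * (coeff P i * z ^ (i - Suc k))"]
    by (simp add: mult_ac sum_distrib_left continuous_intros)
  have outer: "circle_weight (\<lambda>\<zeta>. \<Sum>i\<le>L. \<Sum>k<i. (coeff P i * z ^ (i - Suc k)) * (v \<zeta> * \<zeta> ^ k))"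
    using circle_weight_mult[OF v, of "\<lambda>\<zeta>. \<Sum>i\<le>L. \<Sum>k<i. \<zeta> ^ k * (coeff P i * z ^ (i - Suc k))"]
    by (simp add: mult_ac sum_distrib_left continuous_intros)
  have "cauchy_transform (\<lambda>\<zeta>. w \<zeta> * u \<zeta>) z = circle_int (\<lambda>\<zeta>. poly P z * (v \<zeta> / (\<zeta> - z))
      + (\<Sum>i\<le>L. \<Sum>k<i. (coeff P i * z ^ (i - Suc k)) * (v \<zeta> * \<zeta> ^ k)))"
    unfolding cauchy_transform_def
  proof (rule circle_int_cong)
    fix \<zeta> :: complex assume \<zeta>: "\<zeta> \<in> sphere 0 1"
    have P: "poly P \<zeta> = (\<Prod>j=1..L. \<zeta> - \<beta> j)"
      unfolding P_def by (rule prod_roots_poly)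
    have P0: "poly P \<zeta> \<noteq> 0"
      using off \<zeta> by (auto simp: P)
    have wv: "w \<zeta> * u \<zeta> = v \<zeta> * poly P \<zeta>"
      using P0 by (simp add: v_def modified_weight_def P)
    have "poly P \<zeta> - poly P z = (\<Sum>i\<le>L. coeff P i * (\<zeta> ^ i - z ^ i))"
      using prod_roots_poly(2)[of \<beta> L]
      unfolding poly_altdef P_def by (simp only: sum_subtractf right_diff_distrib)
    \<comment> \<open>Each difference \<open>\<zeta> ^ i - z ^ i\<close> is split into
      \<open>\<zeta> - z\<close> times a sum of mixed monomials.\<close>
    also have "\<dots> = (\<Sum>i\<le>L. \<Sum>k<i. coeff P i * ((\<zeta> - z) * (z ^ (i - Suc k) * \<zeta> ^ k)))"
      by (simp add: power_diff_sumr2 sum_distrib_left)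
    also have "\<dots> = (\<zeta> - z) * (\<Sum>i\<le>L. \<Sum>k<i. (coeff P i * z ^ (i - Suc k)) * \<zeta> ^ k)"
      by (simp add: sum_distrib_left mult_ac)
    finally have diff: "poly P \<zeta> = poly P z
        + (\<zeta> - z) * (\<Sum>i\<le>L. \<Sum>k<i. (coeff P i * z ^ (i - Suc k)) * \<zeta> ^ k)"
      by (simp add: algebra_simps)
    have "\<zeta> - z \<noteq> 0" using \<zeta> assms(6) by auto
    then show "w \<zeta> * u \<zeta> / (\<zeta> - z) = poly P z * (v \<zeta> / (\<zeta> - z))
        + (\<Sum>i\<le>L. \<Sum>k<i. (coeff P i * z ^ (i - Suc k)) * (v \<zeta> * \<zeta> ^ k))"
      unfolding wv diff by (simp add: field_simps sum_distrib_left)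
  qed
  also have "\<dots> = poly P z * cauchy_transform v z
      + (\<Sum>i\<le>L. circle_int (\<lambda>\<zeta>. \<Sum>k<i. (coeff P i * z ^ (i - Suc k)) * (v \<zeta> * \<zeta> ^ k)))"
    by (subst circle_int_add[OF kernel outer], subst circle_int_cmult,
        subst circle_int_sum[OF _ inner]) (simp_all add: cauchy_transform_def)
  also have "(\<Sum>i\<le>L. circle_int (\<lambda>\<zeta>. \<Sum>k<i. (coeff P i * z ^ (i - Suc k)) * (v \<zeta> * \<zeta> ^ k)))
      = (\<Sum>i\<le>L. \<Sum>k<i. coeff P i * circle_int (\<lambda>\<zeta>. v \<zeta> * \<zeta> ^ k) * z ^ (i - Suc k))"
    by (subst circle_int_sum[OF _ monomial], simp, subst circle_int_cmult) (simp add: mult_ac)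
  finally show ?thesis .
qed

section \<open>Interpolation at the nodes \<open>\<beta> r\<close>\<close>

lemma sum_descending_monoms_eq_0:
  fixes \<beta> :: "nat \<Rightarrow> complex"
  assumes "inj_on \<beta> {1..L}" and "n < L"
    and "\<And>r. r \<in> {1..L} \<Longrightarrow> (\<Sum>j<L - n. \<beta> r ^ (L - n - 1 - j) * b j) = 0" and "j < L - n"
  shows "b j = 0"
proof -
  define B where "B = (\<Sum>j<L - n. monom (b j) (L - n - 1 - j))"
  have "degree B < L"
    unfolding B_def using assms(2)
    by (intro degree_sum_less) (auto intro!: le_less_trans[OF degree_monom_le])
  then have "B = 0"
    by (rule poly_eq_0_if_vanishes_on_image[OF _ assms(1)])
      (use assms(3) in \<open>simp add: B_def poly_sum poly_monom mult.commute\<close>)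
  have "coeff B (L - n - 1 - j) = b j"
  proof -
    have "coeff B (L - n - 1 - j) = (\<Sum>i<L - n. if i = j then b i else 0)"
      unfolding B_def coeff_sum coeff_monom using assms(4) by (intro sum.cong) auto
    then show ?thesis using assms(4) by simp
  qed
  with \<open>B = 0\<close> show ?thesis by simp
qed

text \<open>Both claims come from \<open>B + Q = 0\<close>, where \<open>Q\<close> is the polynomial
  part of the transform: the sum has degree below \<open>L\<close> and vanishes at \<open>L\<close>
  distinct nodes, because \<open>P\<close> vanishes there. The second claim uses the coefficients of
  \<open>Q\<close> that \<open>B\<close>, of degree at most \<open>L - n - 1\<close>, cannot
  cancel.\<close>

lemma cauchy_transform_interpolation:
  fixes L :: nat and \<beta> :: "nat \<Rightarrow> complex" and w u :: "complex \<Rightarrow> complex"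
  defines "v \<equiv> \<lambda>\<zeta>. modified_weight w L \<beta> \<zeta> * u \<zeta>"
  assumes weight: "circle_weight w" and cont: "continuous_on (sphere 0 1) u"
    and inj: "inj_on \<beta> {1..L}" and off: "\<And>j. j \<in> {1..L} \<Longrightarrow> \<beta> j \<notin> sphere 0 1" and "n < L"
    and zeros: "\<And>r. r \<in> {1..L} \<Longrightarrow>
      (\<Sum>j<L - n. \<beta> r ^ (L - n - 1 - j) * b j) + cauchy_transform (\<lambda>\<zeta>. w \<zeta> * u \<zeta>) (\<beta> r) = 0"
  shows "z \<notin> sphere 0 1 \<Longrightarrow> (\<Sum>j<L - n. z ^ (L - n - 1 - j) * b j) + cauchy_transform (\<lambda>\<zeta>. w \<zeta> * u \<zeta>) z
      = (\<Prod>j=1..L. z - \<beta> j) * cauchy_transform v z" (is "_ \<Longrightarrow> ?eq z")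
    and "k < n \<Longrightarrow> circle_int (\<lambda>\<zeta>. v \<zeta> * \<zeta> ^ k) = 0"
proof -
  define P where "P = (\<Prod>j=1..L. [:- \<beta> j, 1:])"
  have P: "poly P z = (\<Prod>j=1..L. z - \<beta> j)" for z
    unfolding P_def by (rule prod_roots_poly)
  have monic: "coeff P L = 1"
    unfolding P_def by (rule prod_roots_poly)
  define \<mu> where "\<mu> k = circle_int (\<lambda>\<zeta>. v \<zeta> * \<zeta> ^ k)" for k
  define B where "B = (\<Sum>j<L - n. monom (b j) (L - n - 1 - j))"
  define Q where "Q = (\<Sum>i\<le>L. \<Sum>k<i. monom (coeff P i * \<mu> k) (i - Suc k))"
  have B: "poly B z = (\<Sum>j<L - n. z ^ (L - n - 1 - j) * b j)" for z
    by (simp add: B_def poly_sum poly_monom mult.commute)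
  have transform: "cauchy_transform (\<lambda>\<zeta>. w \<zeta> * u \<zeta>) z = poly P z * cauchy_transform v z + poly Q z"
    if "z \<notin> sphere 0 1" for z
    using cauchy_transform_modified_weight[OF weight cont off that]
    by (simp add: P_def Q_def \<mu>_def v_def poly_sum poly_monom)
  have "degree (B + Q) < L"
    unfolding B_def Q_def using \<open>n < L\<close>
    by (intro degree_add_less degree_sum_less) (auto intro!: le_less_trans[OF degree_monom_le])
  then have BQ: "B + Q = 0"
  proof (rule poly_eq_0_if_vanishes_on_image[OF _ inj])
    fix r assume r: "r \<in> {1..L}"
    have "poly P (\<beta> r) = 0"
      using r by (auto simp: P)
    then show "poly (B + Q) (\<beta> r) = 0"
      using zeros[OF r] transform[OF off[OF r]] by (simp add: B)
  qed
  show "?eq z" if "z \<notin> sphere 0 1"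
    using transform[OF that] arg_cong[OF BQ, of "\<lambda>p. poly p z"] by (simp add: B P algebra_simps)
  \<comment> \<open>Coefficient \<open>L - Suc k\<close> of \<open>Q\<close> is
    \<open>\<mu> k\<close>, with factor \<open>coeff P L = 1\<close>, plus multiples of earlier
    moments. The system is triangular, so strong induction solves it.\<close>
  have "\<mu> k = 0" if "k < n" for k
    using that
  proof (induction k rule: less_induct)
    case (less k)
    have "coeff Q (L - Suc k) = (\<Sum>i\<le>L. \<Sum>k'<i. if i = L \<and> k' = k then \<mu> k else 0)"
      unfolding Q_def coeff_sum
    proof (intro sum.cong refl)
      fix i k' assume "i \<in> {..L}" "k' \<in> {..<i}"
      \<comment> \<open>A pair contributes only if \<open>i - k' = L - k\<close>; then
        \<open>i \<le> L\<close> forces \<open>k' \<le> k\<close>, with equality only for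
        \<open>i = L\<close>. Smaller \<open>k'\<close> fall under the induction hypothesis.\<close>
      then consider "k' < k" | "k' = k" "i = L" | "i - Suc k' \<noteq> L - Suc k" "\<not> (i = L \<and> k' = k)"
        using less.prems \<open>n < L\<close> by force
      then show "coeff (monom (coeff P i * \<mu> k') (i - Suc k')) (L - Suc k)
          = (if i = L \<and> k' = k then \<mu> k else 0)"
        by cases (use less in \<open>auto simp: monic\<close>)
    qed
    also have "\<dots> = (\<Sum>i\<le>L. if i = L then \<mu> k else 0)"
      using less.prems \<open>n < L\<close> by (intro sum.cong) auto
    also have "\<dots> = \<mu> k" by simp
    finally have "coeff Q (L - Suc k) = \<mu> k" .
    \<comment> \<open>\<open>k < n\<close> puts this exponent above \<open>L - n - 1\<close>, the
      largest one in \<open>B\<close>.\<close>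
    moreover have "coeff B (L - Suc k) = 0"
      unfolding B_def coeff_sum using less.prems \<open>n < L\<close> by (intro sum.neutral) auto
    ultimately show ?case
      using arg_cong[OF BQ, of "\<lambda>p. coeff p (L - Suc k)"] by simp
  qed
  then show "k < n \<Longrightarrow> circle_int (\<lambda>\<zeta>. v \<zeta> * \<zeta> ^ k) = 0"
    by (simp add: \<mu>_def)
qed

text \<open>The core shared by both polynomial families. \<open>\<sigma> r\<close> is a common
  factor of row \<open>r\<close>, later 1 or \<open>\<beta> r\<close>; \<open>t\<close> becomes the
  leading-coefficient functional, and \<open>trivial\<close> is the uniqueness that each family
  supplies in its own way.\<close>

lemma bordered_det_interpolation:
  fixes w :: "complex \<Rightarrow> complex" and \<beta> :: "nat \<Rightarrow> complex" and g :: "nat \<Rightarrow> complex \<Rightarrow> complex"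
  assumes weight: "circle_weight w" and inj: "inj_on \<beta> {1..L}"
    and off: "\<And>j. j \<in> {1..L} \<Longrightarrow> \<beta> j \<notin> sphere 0 1" and "n < L"
    and cont: "\<And>m. m \<le> n \<Longrightarrow> continuous_on (sphere 0 1) (g m)"
    and \<sigma>: "\<And>r. r \<in> {1..L} \<Longrightarrow> \<sigma> r \<noteq> 0"
    and q: "\<And>r j. \<lbrakk>r \<in> {1..L}; j < L - n\<rbrakk> \<Longrightarrow> q r j = \<sigma> r * \<beta> r ^ (L - n - 1 - j)"
    and h: "\<And>r m. \<lbrakk>r \<in> {1..L}; m \<le> n\<rbrakk> \<Longrightarrow> h r m = \<sigma> r * cauchy_transform (\<lambda>\<zeta>. w \<zeta> * g m \<zeta>) (\<beta> r)"
    and trivial: "\<And>a. \<lbrakk>\<And>k. k < n \<Longrightarrow>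
          circle_int (\<lambda>\<zeta>. modified_weight w L \<beta> \<zeta> * (\<Sum>m\<le>n. a m * g m \<zeta>) * \<zeta> ^ k) = 0;
        (\<Sum>m\<le>n. t m * a m) = 0\<rbrakk> \<Longrightarrow> \<forall>m\<le>n. a m = 0"
  obtains b a where
    "\<And>p f. bordered_det L n p f q h = (\<Sum>j<L - n. p j * b j) + (\<Sum>m\<le>n. f m * a m)"
    and "(\<Sum>m\<le>n. t m * a m) \<noteq> 0"
    and "\<And>k. k < n \<Longrightarrow>
      circle_int (\<lambda>\<zeta>. modified_weight w L \<beta> \<zeta> * (\<Sum>m\<le>n. a m * g m \<zeta>) * \<zeta> ^ k) = 0"
    and "\<And>z. z \<notin> sphere 0 1 \<Longrightarrow> (\<Sum>j<L - n. z ^ (L - n - 1 - j) * b j)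
        + (\<Sum>m\<le>n. cauchy_transform (\<lambda>\<zeta>. w \<zeta> * g m \<zeta>) z * a m)
      = (\<Prod>j=1..L. z - \<beta> j) * cauchy_transform (\<lambda>\<zeta>. modified_weight w L \<beta> \<zeta> * (\<Sum>m\<le>n. a m * g m \<zeta>)) z"
proof -
  have transform_sum: "cauchy_transform (\<lambda>\<zeta>. w \<zeta> * (\<Sum>m\<le>n. a m * g m \<zeta>)) z
      = (\<Sum>m\<le>n. cauchy_transform (\<lambda>\<zeta>. w \<zeta> * g m \<zeta>) z * a m)" if "z \<notin> sphere 0 1" for a z
  proof -
    have "(\<lambda>\<zeta>. w \<zeta> * (\<Sum>m\<le>n. a m * g m \<zeta>)) = (\<lambda>\<zeta>. \<Sum>m\<le>n. a m * (w \<zeta> * g m \<zeta>))"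
      by (simp add: sum_distrib_left mult_ac)
    then show ?thesis
      using cauchy_transform_sum[of "{..n}" "\<lambda>m \<zeta>. w \<zeta> * g m \<zeta>" z a] that
      by (simp add: circle_weight_mult weight cont mult_ac)
  qed
  have cont_sum: "continuous_on (sphere 0 1) (\<lambda>\<zeta>. \<Sum>m\<le>n. a m * g m \<zeta>)" for a
    using cont by (intro continuous_intros) auto
  have zeros: "(\<Sum>j<L - n. \<beta> r ^ (L - n - 1 - j) * b j)
      + cauchy_transform (\<lambda>\<zeta>. w \<zeta> * (\<Sum>m\<le>n. a m * g m \<zeta>)) (\<beta> r) = 0"
    if "(\<Sum>j<L - n. q r j * b j) + (\<Sum>m\<le>n. h r m * a m) = 0" and r: "r \<in> {1..L}" for b a r
  proof -
    \<comment> \<open>Once the nonzero \<open>\<sigma> r\<close> is split off, orthogonality to row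
      \<open>r\<close> is an interpolation condition at \<open>\<beta> r\<close>.\<close>
    have "(\<Sum>j<L - n. q r j * b j) + (\<Sum>m\<le>n. h r m * a m)
        = \<sigma> r * ((\<Sum>j<L - n. \<beta> r ^ (L - n - 1 - j) * b j)
          + cauchy_transform (\<lambda>\<zeta>. w \<zeta> * (\<Sum>m\<le>n. a m * g m \<zeta>)) (\<beta> r))"
      unfolding transform_sum[OF off[OF r]]
      by (simp add: q[OF r] h[OF r] sum_distrib_left distrib_left mult.assoc)
    then show ?thesis
      using that \<sigma>[OF r] by simp
  qed
  obtain b a where
    expansion: "\<And>p f. bordered_det L n p f q h = (\<Sum>j<L - n. p j * b j) + (\<Sum>m\<le>n. f m * a m)"
    and kernel: "\<And>r. r \<in> {1..L} \<Longrightarrow> (\<Sum>j<L - n. q r j * b j) + (\<Sum>m\<le>n. h r m * a m) = 0"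
    and t: "(\<Sum>m\<le>n. t m * a m) \<noteq> 0"
  proof (rule bordered_det_expansion[OF \<open>n < L\<close>])
    fix b a
    assume kernel: "\<And>r. r \<in> {1..L} \<Longrightarrow> (\<Sum>j<L - n. q r j * b j) + (\<Sum>m\<le>n. h r m * a m) = 0"
      and "(\<Sum>m\<le>n. t m * a m) = 0"
    \<comment> \<open>Any vector orthogonal to the lower rows satisfies the moment conditions, so
      \<open>trivial\<close> removes \<open>a\<close>. What remains is a polynomial with more zeros
      than its degree allows, which removes \<open>b\<close>.\<close>
    then have a: "\<forall>m\<le>n. a m = 0"
      using cauchy_transform_interpolation(2)[OF weight cont_sum inj off \<open>n < L\<close> zeros[OF kernel]]
      by (intro trivial) auto
    have "(\<Sum>j<L - n. \<beta> r ^ (L - n - 1 - j) * b j) = 0" if "r \<in> {1..L}" for r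
      using zeros[OF kernel[OF that] that] a by (simp add: cauchy_transform_def circle_int_eq)
    then have "b j = 0" if "j < L - n" for j
      using sum_descending_monoms_eq_0[OF inj \<open>n < L\<close>] that by blast
    with a show "(\<forall>j<L - n. b j = 0) \<and> (\<forall>m\<le>n. a m = 0)"
      by blast
  qed (rule that)
  note interpolation = cauchy_transform_interpolation[OF weight cont_sum inj off \<open>n < L\<close> zeros[OF kernel]]
  show thesis
  proof (rule that[OF expansion t])
    show "circle_int (\<lambda>\<zeta>. modified_weight w L \<beta> \<zeta> * (\<Sum>m\<le>n. a m * g m \<zeta>) * \<zeta> ^ k) = 0"
      if "k < n" for k
      using interpolation(2) that by blast
    show "(\<Sum>j<L - n. z ^ (L - n - 1 - j) * b j)
        + (\<Sum>m\<le>n. cauchy_transform (\<lambda>\<zeta>. w \<zeta> * g m \<zeta>) z * a m)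
      = (\<Prod>j=1..L. z - \<beta> j) * cauchy_transform (\<lambda>\<zeta>. modified_weight w L \<beta> \<zeta> * (\<Sum>m\<le>n. a m * g m \<zeta>)) z"
      if "z \<notin> sphere 0 1" for z
    proof -
      have "(\<Sum>j<L - n. z ^ (L - n - 1 - j) * b j) + cauchy_transform (\<lambda>\<zeta>. w \<zeta> * (\<Sum>m\<le>n. a m * g m \<zeta>)) z
        = (\<Prod>j=1..L. z - \<beta> j) * cauchy_transform (\<lambda>\<zeta>. modified_weight w L \<beta> \<zeta> * (\<Sum>m\<le>n. a m * g m \<zeta>)) z"
        using interpolation(1) that by blast
      then show ?thesis
        by (simp only: transform_sum[OF that])
    qed
  qed
qed

section \<open>Bi-orthogonal systems\<close>

text \<open>Both index orders occur among the moment matrices of the two families; transposition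
  identifies their determinants.\<close>

lemma toeplitz_det_transpose:
  "Determinant.det (mat n n (\<lambda>(j, k). fourier_coeff w (int k - int j))) = toeplitz_det w n"
proof -
  have "mat n n (\<lambda>(j, k). fourier_coeff w (int k - int j))
      = transpose_mat (mat n n (\<lambda>(j, k). fourier_coeff w (int j - int k)))"
    by (auto simp: mat_eq_iff)
  then show ?thesis
    using det_transpose[OF mat_carrier, of n "\<lambda>(j, k). fourier_coeff w (int j - int k)"]
    by (simp add: toeplitz_det_def)
qed

text \<open>Supplies the linearity of the abstract functionals above: \<open>h\<close> will be the
  identity or \<open>1 / \<zeta>\<close>, and \<open>g\<close> the fixed function tested
  against.\<close>

lemma circle_int_poly_linear:
  assumes "circle_weight w" and "continuous_on (sphere 0 1) h" and "continuous_on (sphere 0 1) g"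
  shows "circle_int (\<lambda>\<zeta>. w \<zeta> * g \<zeta> * poly (p + q) (h \<zeta>))
      = circle_int (\<lambda>\<zeta>. w \<zeta> * g \<zeta> * poly p (h \<zeta>)) + circle_int (\<lambda>\<zeta>. w \<zeta> * g \<zeta> * poly q (h \<zeta>))"
    and "circle_int (\<lambda>\<zeta>. w \<zeta> * g \<zeta> * poly (Polynomial.smult c p) (h \<zeta>))
      = c * circle_int (\<lambda>\<zeta>. w \<zeta> * g \<zeta> * poly p (h \<zeta>))"
proof -
  have "circle_weight (\<lambda>\<zeta>. w \<zeta> * g \<zeta> * poly p (h \<zeta>))" for p
    by (intro circle_weight_mult continuous_intros assms)
  then show "circle_int (\<lambda>\<zeta>. w \<zeta> * g \<zeta> * poly (p + q) (h \<zeta>))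
      = circle_int (\<lambda>\<zeta>. w \<zeta> * g \<zeta> * poly p (h \<zeta>)) + circle_int (\<lambda>\<zeta>. w \<zeta> * g \<zeta> * poly q (h \<zeta>))"
    by (simp add: distrib_left circle_int_add)
  show "circle_int (\<lambda>\<zeta>. w \<zeta> * g \<zeta> * poly (Polynomial.smult c p) (h \<zeta>))
      = c * circle_int (\<lambda>\<zeta>. w \<zeta> * g \<zeta> * poly p (h \<zeta>))"
    by (simp add: mult.left_commute flip: circle_int_cmult)
qed

lemma circle_ne_0: "norm \<zeta> = 1 \<Longrightarrow> \<zeta> \<noteq> (0::complex)"
  by auto

lemma continuous_on_circle_inverse: "continuous_on (sphere 0 1) (\<lambda>\<zeta>::complex. 1 / \<zeta>)"
  by (intro continuous_intros) auto

context
  fixes w :: "complex \<Rightarrow> complex" and \<phi> \<psi> :: "nat \<Rightarrow> complex poly"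
  assumes weight: "circle_weight w" and system: "biorthogonal_system w \<phi> \<psi>"
begin

section \<open>Orthogonality and uniqueness within one system\<close>

lemma biorthogonal_degree:
  shows "degree (\<phi> n) = n" and "degree (\<psi> n) = n"
  using system by (auto simp: biorthogonal_system_def)

lemma biorthogonal_coeff_eq_0: "n < i \<Longrightarrow> coeff (\<phi> n) i = 0" "n < i \<Longrightarrow> coeff (\<psi> n) i = 0"
  by (simp_all add: coeff_eq_0 biorthogonal_degree)

text \<open>For \<open>n = 0\<close> the degree condition admits the zero polynomial, whose
  \<open>degree\<close> is 0; the normalisation of the integral to 1 excludes it.\<close>

lemma biorthogonal_lead_coeff_ne_0: "coeff (\<phi> n) n \<noteq> 0" "coeff (\<psi> n) n \<noteq> 0"
proof -
  have int: "circle_int (\<lambda>\<zeta>. w \<zeta> * poly (\<phi> n) \<zeta> * poly (\<psi> n) (1 / \<zeta>)) = 1"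
    using system by (simp add: biorthogonal_system_def)
  have "\<phi> n \<noteq> 0" "\<psi> n \<noteq> 0"
    using int by (auto simp: circle_int_eq)
  then show "coeff (\<phi> n) n \<noteq> 0" "coeff (\<psi> n) n \<noteq> 0"
    using biorthogonal_degree[of n] by (metis leading_coeff_0_iff)+
qed

text \<open>\<open>\<psi> 0, ..., \<psi> (n - 1)\<close> span the polynomials of degree below
  \<open>n\<close>, so orthogonality to them extends to all of these.\<close>

lemma biorthogonal_orthogonal:
  assumes "\<And>i. n \<le> i \<Longrightarrow> coeff q i = 0"
  shows "circle_int (\<lambda>\<zeta>. w \<zeta> * poly (\<phi> n) \<zeta> * poly q (1 / \<zeta>)) = 0"
proof -
  have cont: "continuous_on (sphere 0 1) (poly (\<phi> n))"
    by (intro continuous_intros)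
  show ?thesis
  proof (rule linear_functional_expansion[of _ \<psi> n])
    show "circle_int (\<lambda>\<zeta>. w \<zeta> * poly (\<phi> n) \<zeta> * poly (\<psi> k) (1 / \<zeta>)) = 0" if "k < n" for k
      using system that by (simp add: biorthogonal_system_def)
  qed (rule circle_int_poly_linear[OF weight continuous_on_circle_inverse cont] |
      simp add: biorthogonal_lead_coeff_ne_0 biorthogonal_coeff_eq_0 assms)+
qed

lemma biorthogonal_orthogonal_star:
  assumes "\<And>i. n \<le> i \<Longrightarrow> coeff q i = 0"
  shows "circle_int (\<lambda>\<zeta>. w \<zeta> * poly (\<psi> n) (1 / \<zeta>) * poly q \<zeta>) = 0"
proof -
  have cont: "continuous_on (sphere 0 1) (\<lambda>\<zeta>. poly (\<psi> n) (1 / \<zeta>))"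
    by (intro continuous_intros) auto
  show ?thesis
  proof (rule linear_functional_expansion[of _ \<phi> n])
    show "circle_int (\<lambda>\<zeta>. w \<zeta> * poly (\<psi> n) (1 / \<zeta>) * poly (\<phi> k) \<zeta>) = 0" if "k < n" for k
      using system that by (simp add: biorthogonal_system_def mult_ac)
  qed (rule circle_int_poly_linear[OF weight continuous_on_id cont] |
      simp add: biorthogonal_lead_coeff_ne_0 biorthogonal_coeff_eq_0 assms)+
qed

text \<open>The moments of \<open>\<zeta> ^ i\<close> against \<open>(1 / \<zeta>) ^ k\<close> are
  the Fourier coefficients of index \<open>k - i\<close>. Their matrix has determinant
  \<open>toeplitz_det w n\<close>, nonzero in a bi-orthogonal system.\<close>

lemma biorthogonal_unique:
  assumes "\<And>i. n < i \<Longrightarrow> coeff p i = 0"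
    and "\<And>k. k < n \<Longrightarrow> circle_int (\<lambda>\<zeta>. w \<zeta> * (1 / \<zeta>) ^ k * poly p \<zeta>) = 0"
  shows "p = Polynomial.smult (coeff p n / coeff (\<phi> n) n) (\<phi> n)"
proof -
  have cont: "continuous_on (sphere 0 1) (\<lambda>\<zeta>::complex. (1 / \<zeta>) ^ k)" for k
    by (intro continuous_intros) auto
  have cont_id: "continuous_on (sphere 0 1) (\<lambda>\<zeta>::complex. \<zeta>)"
    by (intro continuous_intros)
  show ?thesis
  proof (rule eq_smult_if_annihilated[where \<Lambda> = "\<lambda>k p. circle_int (\<lambda>\<zeta>. w \<zeta> * (1 / \<zeta>) ^ k * poly p \<zeta>)"])
    have "circle_int (\<lambda>\<zeta>. w \<zeta> * (1 / \<zeta>) ^ k * poly (monom 1 i) \<zeta>) = fourier_coeff w (int k - int i)" for k i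
      unfolding fourier_coeff_def
      by (intro circle_int_cong)
        (auto simp: poly_monom power_int_diff power_divide dest!: circle_ne_0)
    then show "Determinant.det (mat n n
        (\<lambda>(k, i). circle_int (\<lambda>\<zeta>. w \<zeta> * (1 / \<zeta>) ^ k * poly (monom 1 i) \<zeta>))) \<noteq> 0"
      using system by (simp add: biorthogonal_system_def toeplitz_det_def)
    show "circle_int (\<lambda>\<zeta>. w \<zeta> * (1 / \<zeta>) ^ k * poly (\<phi> n) \<zeta>) = 0" if "k < n" for k
      using biorthogonal_orthogonal[of n "monom 1 k"] that by (simp add: poly_monom mult_ac)
  qed (rule circle_int_poly_linear[OF weight cont_id cont] |
      simp add: biorthogonal_lead_coeff_ne_0 biorthogonal_coeff_eq_0 assms)+
qed

lemma biorthogonal_unique_star: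
  assumes "\<And>i. n < i \<Longrightarrow> coeff p i = 0"
    and "\<And>k. k < n \<Longrightarrow> circle_int (\<lambda>\<zeta>. w \<zeta> * \<zeta> ^ k * poly p (1 / \<zeta>)) = 0"
  shows "p = Polynomial.smult (coeff p n / coeff (\<psi> n) n) (\<psi> n)"
proof -
  have cont: "continuous_on (sphere 0 1) (\<lambda>\<zeta>::complex. \<zeta> ^ k)" for k
    by (intro continuous_intros)
  show ?thesis
  proof (rule eq_smult_if_annihilated[where \<Lambda> = "\<lambda>k p. circle_int (\<lambda>\<zeta>. w \<zeta> * \<zeta> ^ k * poly p (1 / \<zeta>))"])
    have "circle_int (\<lambda>\<zeta>. w \<zeta> * \<zeta> ^ k * poly (monom 1 i) (1 / \<zeta>)) = fourier_coeff w (int i - int k)" for k i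
      unfolding fourier_coeff_def
      by (intro circle_int_cong)
        (auto simp: poly_monom power_int_diff power_divide dest!: circle_ne_0)
    then show "Determinant.det (mat n n
        (\<lambda>(k, i). circle_int (\<lambda>\<zeta>. w \<zeta> * \<zeta> ^ k * poly (monom 1 i) (1 / \<zeta>)))) \<noteq> 0"
      using system by (simp add: biorthogonal_system_def toeplitz_det_transpose)
    show "circle_int (\<lambda>\<zeta>. w \<zeta> * \<zeta> ^ k * poly (\<psi> n) (1 / \<zeta>)) = 0" if "k < n" for k
      using biorthogonal_orthogonal_star[of n "monom 1 k"] that by (simp add: poly_monom mult_ac)
  qed (rule circle_int_poly_linear[OF weight continuous_on_circle_inverse cont] |
      simp add: biorthogonal_lead_coeff_ne_0 biorthogonal_coeff_eq_0 assms)+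
qed

text \<open>For \<open>m = 0\<close> the term \<open>fourier_coeff w 0\<close> turns the kernel into
  \<open>2 * \<zeta> / (\<zeta> - z)\<close>. For \<open>m > 0\<close> the kernel differs from
  \<open>2 * \<zeta> * (z / \<zeta>) ^ m / (\<zeta> - z)\<close> by a polynomial in
  \<open>1 / \<zeta>\<close> of degree below \<open>m\<close>, which orthogonality
  annihilates.\<close>

lemma assoc_fun_eq_cauchy_transform:
  assumes "z \<notin> sphere 0 1"
  shows "assoc_fun w \<phi> m z = z ^ m * cauchy_transform (\<lambda>\<zeta>. w \<zeta> * (2 * \<zeta> / \<zeta> ^ m * poly (\<phi> m) \<zeta>)) z"
proof -
  have kernel: "circle_weight (\<lambda>\<zeta>. z ^ m * (w \<zeta> * (2 * \<zeta> / \<zeta> ^ m * poly (\<phi> m) \<zeta>) / (\<zeta> - z)))"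
    by (rule circle_weightI[OF weight, of "\<lambda>\<zeta>. z ^ m * (2 * \<zeta> / \<zeta> ^ m * poly (\<phi> m) \<zeta> / (\<zeta> - z))"])
      (use assms in \<open>auto intro!: continuous_intros\<close>)
  show ?thesis
  proof (cases "m = 0")
    case True
    obtain c where c: "\<phi> 0 = [:c:]"
      using biorthogonal_degree(1)[of 0] by (rule degree_eq_zeroE)
    have weight': "circle_weight (\<lambda>\<zeta>. (\<zeta> + z) / (\<zeta> - z) * w \<zeta>)"
      by (rule circle_weightI[OF weight, of "\<lambda>\<zeta>. (\<zeta> + z) / (\<zeta> - z)"])
        (use assms in \<open>auto intro!: continuous_intros\<close>)
    have "assoc_fun w \<phi> 0 z = circle_int (\<lambda>\<zeta>. c * (w \<zeta> + (\<zeta> + z) / (\<zeta> - z) * w \<zeta>))"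
      unfolding circle_int_cmult circle_int_add[OF weight weight']
      by (simp add: assoc_fun_def c fourier_coeff_def caratheodory_fun_def)
    also have "\<dots> = cauchy_transform (\<lambda>\<zeta>. w \<zeta> * (2 * \<zeta> * c)) z"
      unfolding cauchy_transform_def
      using assms by (intro circle_int_cong) (auto simp: divide_simps, simp add: algebra_simps)
    finally show ?thesis
      by (simp add: True c)
  next
    case False
    \<comment> \<open>\<open>q\<close> collects the terms of order below \<open>m\<close> in the
      expansion of the kernel in powers of \<open>z / \<zeta>\<close>. The geometric sum is finite,
      so the identity holds inside and outside the circle.\<close>
    define q where "q = Polynomial.smult 2 (\<Sum>k<m. monom (z ^ k) k) - 1"
    have q: "poly q x = 2 * (\<Sum>k<m. (z * x) ^ k) - 1" for x
      by (simp add: q_def poly_sum poly_monom power_mult_distrib)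
    have weight': "circle_weight (\<lambda>\<zeta>. w \<zeta> * poly (\<phi> m) \<zeta> * poly q (1 / \<zeta>))"
      by (intro circle_weight_mult weight continuous_intros) auto
    have "assoc_fun w \<phi> m z = circle_int (\<lambda>\<zeta>. (\<zeta> + z) / (\<zeta> - z) * w \<zeta> * poly (\<phi> m) \<zeta>)"
      using False by (simp add: assoc_fun_def)
    also have "\<dots> = circle_int (\<lambda>\<zeta>. z ^ m * (w \<zeta> * (2 * \<zeta> / \<zeta> ^ m * poly (\<phi> m) \<zeta>) / (\<zeta> - z))
        + w \<zeta> * poly (\<phi> m) \<zeta> * poly q (1 / \<zeta>))"
    proof (rule circle_int_cong)
      fix \<zeta> :: complex assume "\<zeta> \<in> sphere 0 1"
      then have nz: "\<zeta> \<noteq> 0" "\<zeta> - z \<noteq> 0" "z / \<zeta> \<noteq> 1"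
        using assms by auto
      have "(\<Sum>k<m. (z * (1 / \<zeta>)) ^ k) = ((z / \<zeta>) ^ m - 1) / (z / \<zeta> - 1)"
        using geometric_sum[OF nz(3)] by simp
      also have "\<dots> = \<zeta> * (1 - z ^ m / \<zeta> ^ m) / (\<zeta> - z)"
        using nz by (simp add: divide_simps) (simp add: algebra_simps)
      finally have "poly q (1 / \<zeta>) = 2 * (\<zeta> * (1 - z ^ m / \<zeta> ^ m) / (\<zeta> - z)) - 1"
        by (simp only: q)
      also have "\<dots> = (\<zeta> + z) / (\<zeta> - z) - 2 * \<zeta> * z ^ m / (\<zeta> ^ m * (\<zeta> - z))"
        using nz by (simp add: divide_simps) (simp add: algebra_simps)
      finally have q': "(\<zeta> + z) / (\<zeta> - z) = poly q (1 / \<zeta>) + z ^ m * (2 * \<zeta> / \<zeta> ^ m) / (\<zeta> - z)"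
        by (simp add: mult_ac)
      show "(\<zeta> + z) / (\<zeta> - z) * w \<zeta> * poly (\<phi> m) \<zeta>
        = z ^ m * (w \<zeta> * (2 * \<zeta> / \<zeta> ^ m * poly (\<phi> m) \<zeta>) / (\<zeta> - z)) + w \<zeta> * poly (\<phi> m) \<zeta> * poly q (1 / \<zeta>)"
        unfolding q' by (simp add: distrib_left distrib_right mult_ac)
    qed
    also have "\<dots> = z ^ m * cauchy_transform (\<lambda>\<zeta>. w \<zeta> * (2 * \<zeta> / \<zeta> ^ m * poly (\<phi> m) \<zeta>)) z
        + circle_int (\<lambda>\<zeta>. w \<zeta> * poly (\<phi> m) \<zeta> * poly q (1 / \<zeta>))"
      unfolding cauchy_transform_def circle_int_add[OF kernel weight'] circle_int_cmult ..
    also have "circle_int (\<lambda>\<zeta>. w \<zeta> * poly (\<phi> m) \<zeta> * poly q (1 / \<zeta>)) = 0"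
      using False by (intro biorthogonal_orthogonal) (auto simp: q_def coeff_sum)
    finally show ?thesis by simp
  qed
qed

text \<open>The kernel is \<open>1 + 2 * z / (\<zeta> - z)\<close>. The 1 is removed by
  orthogonality to constants if \<open>m > 0\<close> and by \<open>fourier_coeff w 0\<close> if
  \<open>m = 0\<close>; the numerator supplies the extra power in \<open>z ^ Suc m\<close>.\<close>

lemma assoc_fun_star_eq_cauchy_transform:
  assumes "z \<notin> sphere 0 1"
  shows "assoc_fun_star w \<psi> m z = z ^ Suc m * cauchy_transform (\<lambda>\<zeta>. w \<zeta> * (- 2 * poly (\<psi> m) (1 / \<zeta>))) z"
proof (cases "m = 0")
  case True
  obtain c where c: "\<psi> 0 = [:c:]"
    using biorthogonal_degree(2)[of 0] by (rule degree_eq_zeroE)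
  have weight': "circle_weight (\<lambda>\<zeta>. - 1 * ((\<zeta> + z) / (\<zeta> - z) * w \<zeta>))"
    by (rule circle_weightI[OF weight, of "\<lambda>\<zeta>. - 1 * ((\<zeta> + z) / (\<zeta> - z))"])
      (use assms in \<open>auto intro!: continuous_intros simp: divide_inverse algebra_simps\<close>)
  have "assoc_fun_star w \<psi> 0 z = c * circle_int (\<lambda>\<zeta>. w \<zeta> + - 1 * ((\<zeta> + z) / (\<zeta> - z) * w \<zeta>))"
    unfolding circle_int_add[OF weight weight'] circle_int_cmult
    by (simp add: assoc_fun_star_def c fourier_coeff_def caratheodory_fun_def)
  also have "\<dots> = z * cauchy_transform (\<lambda>\<zeta>. w \<zeta> * (- 2 * c)) z"
    unfolding cauchy_transform_def circle_int_cmult[symmetric]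
    using assms by (intro circle_int_cong) (auto simp: divide_simps, simp add: algebra_simps)
  finally show ?thesis
    by (simp add: True c)
next
  case False
  have kernel: "circle_weight (\<lambda>\<zeta>. - z * (w \<zeta> * (- 2 * poly (\<psi> m) (1 / \<zeta>)) / (\<zeta> - z)))"
    by (rule circle_weightI[OF weight, of "\<lambda>\<zeta>. - z * (- 2 * poly (\<psi> m) (1 / \<zeta>) / (\<zeta> - z))"])
      (use assms in \<open>auto intro!: continuous_intros\<close>)
  have weight': "circle_weight (\<lambda>\<zeta>. w \<zeta> * poly (\<psi> m) (1 / \<zeta>) * poly 1 \<zeta>)"
    by (intro circle_weight_mult weight continuous_intros) auto
  have "circle_int (\<lambda>\<zeta>. (\<zeta> + z) / (\<zeta> - z) * w \<zeta> * poly (\<psi> m) (1 / \<zeta>))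
      = circle_int (\<lambda>\<zeta>. - z * (w \<zeta> * (- 2 * poly (\<psi> m) (1 / \<zeta>)) / (\<zeta> - z))
          + w \<zeta> * poly (\<psi> m) (1 / \<zeta>) * poly 1 \<zeta>)"
    using assms by (intro circle_int_cong) (auto simp: divide_simps, simp add: algebra_simps)
  also have "\<dots> = - z * cauchy_transform (\<lambda>\<zeta>. w \<zeta> * (- 2 * poly (\<psi> m) (1 / \<zeta>))) z
      + circle_int (\<lambda>\<zeta>. w \<zeta> * poly (\<psi> m) (1 / \<zeta>) * poly 1 \<zeta>)"
    unfolding cauchy_transform_def circle_int_add[OF kernel weight'] circle_int_cmult ..
  also have "circle_int (\<lambda>\<zeta>. w \<zeta> * poly (\<psi> m) (1 / \<zeta>) * poly 1 \<zeta>) = 0"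
    using False by (intro biorthogonal_orthogonal_star) auto
  finally show ?thesis
    using False by (simp add: assoc_fun_star_def)
qed

end

section \<open>The determinant formulae\<close>

text \<open>The factors \<open>z ^ (n - m)\<close> raise every \<open>\<phi> m\<close> to degree
  \<open>n\<close>, so the leading coefficient of \<open>P a\<close> combines all
  \<open>coeff (\<phi> m) m\<close>. Recovering \<open>a\<close> from \<open>P a\<close> then rests
  on the constant coefficients, nonzero by \<open>generic\<close>.\<close>

lemma bordered_det_assoc_fun:
  fixes w :: "complex \<Rightarrow> complex" and L n :: nat and \<beta> :: "nat \<Rightarrow> complex"
    and \<phi> \<psi> \<Phi> \<Psi> :: "nat \<Rightarrow> complex poly"
  defines "D \<equiv> \<lambda>p f. bordered_det L n p f (\<lambda>r j. \<beta> r ^ (L - n - 1 - j))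
       (\<lambda>r m. \<beta> r powi (- int m) * assoc_fun w \<phi> m (\<beta> r))"
  assumes weight: "circle_weight w" and "n < L" and inj: "inj_on \<beta> {1..L}"
    and \<beta>: "\<And>j. j \<in> {1..L} \<Longrightarrow> \<beta> j \<noteq> 0 \<and> \<beta> j \<notin> sphere 0 1"
    and system: "biorthogonal_system w \<phi> \<psi>" and generic: "\<And>m. poly (\<phi> m) 0 \<noteq> 0"
    and system': "biorthogonal_system (modified_weight w L \<beta>) \<Phi> \<Psi>"
  shows "\<exists>C. (\<forall>z. poly (\<Phi> n) z = C * D (\<lambda>j. 0) (\<lambda>m. z ^ (n - m) * poly (\<phi> m) z)) \<and>
    (\<forall>z. z \<notin> sphere 0 1 \<longrightarrow> (\<Prod>j=1..L. z - \<beta> j) * assoc_fun (modified_weight w L \<beta>) \<Phi> n z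
      = C * D (\<lambda>j. z ^ (L - 1 - j)) (\<lambda>m. z ^ (n - m) * assoc_fun w \<phi> m z))"
proof -
  have off: "\<beta> j \<notin> sphere 0 1" if "j \<in> {1..L}" for j
    using \<beta>[OF that] by blast
  have weight': "circle_weight (modified_weight w L \<beta>)"
    using weight off by (rule circle_weight_modified)
  define g where "g m \<zeta> = 2 * \<zeta> / \<zeta> ^ m * poly (\<phi> m) \<zeta>" for m \<zeta>
  define P where "P a = (\<Sum>m\<le>n. Polynomial.smult (a m) (monom 1 (n - m) * \<phi> m))" for a
  have poly_P: "poly (P a) z = (\<Sum>m\<le>n. z ^ (n - m) * poly (\<phi> m) z * a m)" for a z
    by (simp add: P_def poly_sum poly_monom mult_ac)
  have coeff_P: "coeff (P a) (n - i) = (\<Sum>m\<le>n. a m * (if m < i then 0 else coeff (\<phi> m) (m - i)))"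
    if "i \<le> n" for a i
    unfolding P_def coeff_sum using that by (intro sum.cong) (auto simp: coeff_monom_mult)
  have coeff_P_n: "coeff (P a) n = (\<Sum>m\<le>n. coeff (\<phi> m) m * a m)" for a
    using coeff_P[of 0 a] by (simp add: mult.commute)
  have P_high: "coeff (P a) i = 0" if "n < i" for a i
    unfolding P_def coeff_sum using that
    by (intro sum.neutral) (auto simp: coeff_monom_mult biorthogonal_coeff_eq_0[OF weight system])
  have sum_g: "(\<Sum>m\<le>n. a m * g m \<zeta>) = 2 * \<zeta> / \<zeta> ^ n * poly (P a) \<zeta>" if "\<zeta> \<noteq> 0" for a \<zeta>
    unfolding poly_P sum_distrib_left
    using that by (intro sum.cong) (auto simp: g_def power_diff)
  have P_eq: "P a = Polynomial.smult (coeff (P a) n / coeff (\<Phi> n) n) (\<Phi> n)"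
    if orth: "\<And>k. k < n \<Longrightarrow>
      circle_int (\<lambda>\<zeta>. modified_weight w L \<beta> \<zeta> * (\<Sum>m\<le>n. a m * g m \<zeta>) * \<zeta> ^ k) = 0" for a
  proof (rule biorthogonal_unique[OF weight' system' P_high])
    fix k assume "k < n"
    \<comment> \<open>The exponent is reversed because the combination of the \<open>g m\<close>
      carries \<open>2 * \<zeta> / \<zeta> ^ n\<close>; the product with
      \<open>\<zeta> ^ (n - Suc k)\<close> is \<open>2 * (1 / \<zeta>) ^ k\<close>.\<close>
    have "circle_int (\<lambda>\<zeta>. modified_weight w L \<beta> \<zeta> * (\<Sum>m\<le>n. a m * g m \<zeta>) * \<zeta> ^ (n - Suc k))
        = circle_int (\<lambda>\<zeta>. 2 * (modified_weight w L \<beta> \<zeta> * (1 / \<zeta>) ^ k * poly (P a) \<zeta>))"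
    proof (rule circle_int_cong)
      fix \<zeta> :: complex assume "\<zeta> \<in> sphere 0 1"
      then have "\<zeta> \<noteq> 0" by auto
      then have pow: "(1 / \<zeta>) ^ k = \<zeta> / \<zeta> ^ n * \<zeta> ^ (n - Suc k)"
        using \<open>k < n\<close> by (simp add: power_diff power_divide)
      show "modified_weight w L \<beta> \<zeta> * (\<Sum>m\<le>n. a m * g m \<zeta>) * \<zeta> ^ (n - Suc k)
          = 2 * (modified_weight w L \<beta> \<zeta> * (1 / \<zeta>) ^ k * poly (P a) \<zeta>)"
        unfolding sum_g[OF \<open>\<zeta> \<noteq> 0\<close>] pow by (simp add: mult_ac)
    qed
    then show "circle_int (\<lambda>\<zeta>. modified_weight w L \<beta> \<zeta> * (1 / \<zeta>) ^ k * poly (P a) \<zeta>) = 0"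
      using orth[of "n - Suc k"] \<open>k < n\<close> unfolding circle_int_cmult by simp
  qed
  have trivial: "\<forall>m\<le>n. a m = 0"
    if "\<And>k. k < n \<Longrightarrow>
        circle_int (\<lambda>\<zeta>. modified_weight w L \<beta> \<zeta> * (\<Sum>m\<le>n. a m * g m \<zeta>) * \<zeta> ^ k) = 0"
      and "(\<Sum>m\<le>n. coeff (\<phi> m) m * a m) = 0" for a
  proof -
    have "P a = 0"
      using P_eq[OF that(1)] that(2) by (simp add: coeff_P_n)
    then have sum: "(\<Sum>m\<le>n. a m * (if m < i then 0 else coeff (\<phi> m) (m - i))) = 0" if "i \<le> n" for i
      using coeff_P[OF that, of a] by simp
    \<comment> \<open>Coefficient \<open>n - i\<close> of \<open>P a\<close> involves only
      \<open>m \<ge> i\<close>, and its diagonal entry is the constant coefficient of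
      \<open>\<phi> i\<close>.\<close>
    show ?thesis
      using triangular_sum_eq_0[where C = "\<lambda>m i. if m < i then 0 else coeff (\<phi> m) (m - i)", OF _ _ sum]
        generic by (simp add: poly_0_coeff_0)
  qed
  have cont: "continuous_on (sphere 0 1) (g m)" for m
    unfolding g_def by (intro continuous_intros) auto
  have entries: "\<beta> r powi (- int m) * assoc_fun w \<phi> m (\<beta> r)
      = 1 * cauchy_transform (\<lambda>\<zeta>. w \<zeta> * g m \<zeta>) (\<beta> r)" if "r \<in> {1..L}" for r m
    using \<beta>[OF that] assoc_fun_eq_cauchy_transform[OF weight system off[OF that], of m]
    by (simp add: g_def power_int_minus)
  obtain b a where
    D: "\<And>p f. D p f = (\<Sum>j<L - n. p j * b j) + (\<Sum>m\<le>n. f m * a m)"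
    and t: "(\<Sum>m\<le>n. coeff (\<phi> m) m * a m) \<noteq> 0"
    and orth: "\<And>k. k < n \<Longrightarrow>
      circle_int (\<lambda>\<zeta>. modified_weight w L \<beta> \<zeta> * (\<Sum>m\<le>n. a m * g m \<zeta>) * \<zeta> ^ k) = 0"
    and interpolation: "\<And>z. z \<notin> sphere 0 1 \<Longrightarrow> (\<Sum>j<L - n. z ^ (L - n - 1 - j) * b j)
        + (\<Sum>m\<le>n. cauchy_transform (\<lambda>\<zeta>. w \<zeta> * g m \<zeta>) z * a m)
      = (\<Prod>j=1..L. z - \<beta> j) * cauchy_transform (\<lambda>\<zeta>. modified_weight w L \<beta> \<zeta> * (\<Sum>m\<le>n. a m * g m \<zeta>)) z"
    unfolding D_def
    by (rule bordered_det_interpolation[OF weight inj off \<open>n < L\<close> cont, where \<sigma> = "\<lambda>_. 1"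
          and q = "\<lambda>r j. \<beta> r ^ (L - n - 1 - j)" and t = "\<lambda>m. coeff (\<phi> m) m"
          and h = "\<lambda>r m. \<beta> r powi (- int m) * assoc_fun w \<phi> m (\<beta> r)"])
      (use entries trivial in auto)
  define c where "c = coeff (P a) n / coeff (\<Phi> n) n"
  have "c \<noteq> 0"
    using t biorthogonal_lead_coeff_ne_0(1)[OF weight' system'] by (simp add: c_def coeff_P_n)
  have P: "P a = Polynomial.smult c (\<Phi> n)"
    unfolding c_def by (rule P_eq[OF orth])
  show ?thesis
  proof (intro exI[of _ "1 / c"] conjI allI impI)
    fix z
    show "poly (\<Phi> n) z = 1 / c * D (\<lambda>j. 0) (\<lambda>m. z ^ (n - m) * poly (\<phi> m) z)"
      using arg_cong[OF P, of "\<lambda>p. poly p z"] \<open>c \<noteq> 0\<close> by (simp add: D poly_P)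
  next
    fix z :: complex assume z: "z \<notin> sphere 0 1"
    \<comment> \<open>The whole top row has the factor \<open>z ^ n\<close>; without it, the
      expansion is the left side of \<open>interpolation\<close>.\<close>
    have "D (\<lambda>j. z ^ (L - 1 - j)) (\<lambda>m. z ^ (n - m) * assoc_fun w \<phi> m z)
        = (\<Sum>j<L - n. z ^ n * (z ^ (L - n - 1 - j) * b j))
          + (\<Sum>m\<le>n. z ^ n * (cauchy_transform (\<lambda>\<zeta>. w \<zeta> * g m \<zeta>) z * a m))"
      unfolding D
    proof (intro arg_cong2[where f = "(+)"] sum.cong refl)
      fix j assume "j \<in> {..<L - n}"
      then have "L - 1 - j = n + (L - n - 1 - j)" by auto
      then show "z ^ (L - 1 - j) * b j = z ^ n * (z ^ (L - n - 1 - j) * b j)"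
        by (simp only: power_add mult.assoc)
    next
      fix m assume "m \<in> {..n}"
      then have "z ^ n = z ^ (n - m) * z ^ m"
        by (simp flip: power_add)
      then show "z ^ (n - m) * assoc_fun w \<phi> m z * a m
          = z ^ n * (cauchy_transform (\<lambda>\<zeta>. w \<zeta> * g m \<zeta>) z * a m)"
        by (simp add: assoc_fun_eq_cauchy_transform[OF weight system z] g_def)
    qed
    also have "\<dots> = z ^ n * ((\<Prod>j=1..L. z - \<beta> j)
        * cauchy_transform (\<lambda>\<zeta>. modified_weight w L \<beta> \<zeta> * (\<Sum>m\<le>n. a m * g m \<zeta>)) z)"
      unfolding interpolation[OF z, symmetric] by (simp add: sum_distrib_left distrib_left)
    also have "cauchy_transform (\<lambda>\<zeta>. modified_weight w L \<beta> \<zeta> * (\<Sum>m\<le>n. a m * g m \<zeta>)) z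
        = cauchy_transform (\<lambda>\<zeta>. c * (modified_weight w L \<beta> \<zeta> * (2 * \<zeta> / \<zeta> ^ n * poly (\<Phi> n) \<zeta>))) z"
    proof (rule cauchy_transform_cong)
      fix \<zeta> :: complex assume "\<zeta> \<in> sphere 0 1"
      then have "\<zeta> \<noteq> 0" by auto
      then show "modified_weight w L \<beta> \<zeta> * (\<Sum>m\<le>n. a m * g m \<zeta>)
          = c * (modified_weight w L \<beta> \<zeta> * (2 * \<zeta> / \<zeta> ^ n * poly (\<Phi> n) \<zeta>))"
        by (simp add: sum_g P)
    qed
    finally show "(\<Prod>j=1..L. z - \<beta> j) * assoc_fun (modified_weight w L \<beta>) \<Phi> n z
        = 1 / c * D (\<lambda>j. z ^ (L - 1 - j)) (\<lambda>m. z ^ (n - m) * assoc_fun w \<phi> m z)"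
      unfolding cauchy_transform_cmult assoc_fun_eq_cauchy_transform[OF weight' system' z]
      using \<open>c \<noteq> 0\<close> by simp
  qed
qed

text \<open>Here \<open>P a\<close> combines the \<open>\<psi> m\<close> without added powers. Its
  coefficients are triangular in \<open>a\<close> by degree, with the leading coefficients on the
  diagonal, and \<open>coeff (\<psi> m) n\<close> selects \<open>m = n\<close>.\<close>

lemma bordered_det_assoc_fun_star:
  fixes w :: "complex \<Rightarrow> complex" and L n :: nat and \<beta> :: "nat \<Rightarrow> complex"
    and \<phi> \<psi> \<Phi> \<Psi> :: "nat \<Rightarrow> complex poly"
  defines "D \<equiv> \<lambda>p f. bordered_det L n p f (\<lambda>r j. \<beta> r ^ (L - n - j))
       (\<lambda>r m. \<beta> r powi (- int m) * assoc_fun_star w \<psi> m (\<beta> r))"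
  assumes weight: "circle_weight w" and "n < L" and inj: "inj_on \<beta> {1..L}"
    and \<beta>: "\<And>j. j \<in> {1..L} \<Longrightarrow> \<beta> j \<noteq> 0 \<and> \<beta> j \<notin> sphere 0 1"
    and system: "biorthogonal_system w \<phi> \<psi>"
    and system': "biorthogonal_system (modified_weight w L \<beta>) \<Phi> \<Psi>"
  shows "\<exists>C. (\<forall>z. poly (recip \<Psi> n) z = C * D (\<lambda>j. 0) (\<lambda>m. z ^ (n - m) * poly (recip \<psi> m) z)) \<and>
    (\<forall>z. z \<notin> sphere 0 1 \<longrightarrow> (\<Prod>j=1..L. z - \<beta> j) * assoc_fun_star (modified_weight w L \<beta>) \<Psi> n z
      = C * D (\<lambda>j. z ^ (L - j)) (\<lambda>m. z ^ (n - m) * assoc_fun_star w \<psi> m z))"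
proof -
  have off: "\<beta> j \<notin> sphere 0 1" if "j \<in> {1..L}" for j
    using \<beta>[OF that] by blast
  have weight': "circle_weight (modified_weight w L \<beta>)"
    using weight off by (rule circle_weight_modified)
  define g where "g m \<zeta> = - 2 * poly (\<psi> m) (1 / \<zeta>)" for m \<zeta>
  define P where "P a = (\<Sum>m\<le>n. Polynomial.smult (a m) (\<psi> m))" for a
  have coeff_P: "coeff (P a) i = (\<Sum>m\<le>n. a m * coeff (\<psi> m) i)" for a i
    by (simp add: P_def coeff_sum)
  have coeff_P_n: "coeff (P a) n = (\<Sum>m\<le>n. coeff (\<psi> m) n * a m)" for a
    by (simp add: coeff_P mult.commute)
  have P_high: "coeff (P a) i = 0" if "n < i" for a i
    unfolding coeff_P using that
    by (intro sum.neutral) (auto simp: biorthogonal_coeff_eq_0[OF weight system])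
  have sum_g: "(\<Sum>m\<le>n. a m * g m \<zeta>) = - 2 * poly (P a) (1 / \<zeta>)" for a \<zeta>
    by (simp add: g_def P_def poly_sum sum_distrib_left mult_ac sum_negf)
  have P_eq: "P a = Polynomial.smult (coeff (P a) n / coeff (\<Psi> n) n) (\<Psi> n)"
    if orth: "\<And>k. k < n \<Longrightarrow>
      circle_int (\<lambda>\<zeta>. modified_weight w L \<beta> \<zeta> * (\<Sum>m\<le>n. a m * g m \<zeta>) * \<zeta> ^ k) = 0" for a
  proof (rule biorthogonal_unique_star[OF weight' system' P_high])
    fix k assume "k < n"
    have "(\<lambda>\<zeta>. modified_weight w L \<beta> \<zeta> * (\<Sum>m\<le>n. a m * g m \<zeta>) * \<zeta> ^ k)
        = (\<lambda>\<zeta>. - 2 * (modified_weight w L \<beta> \<zeta> * \<zeta> ^ k * poly (P a) (1 / \<zeta>)))"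
      unfolding sum_g by (simp add: mult_ac)
    then show "circle_int (\<lambda>\<zeta>. modified_weight w L \<beta> \<zeta> * \<zeta> ^ k * poly (P a) (1 / \<zeta>)) = 0"
      using orth[OF \<open>k < n\<close>] circle_int_cmult[of "- 2"] by simp
  qed
  have trivial: "\<forall>m\<le>n. a m = 0"
    if "\<And>k. k < n \<Longrightarrow>
        circle_int (\<lambda>\<zeta>. modified_weight w L \<beta> \<zeta> * (\<Sum>m\<le>n. a m * g m \<zeta>) * \<zeta> ^ k) = 0"
      and "(\<Sum>m\<le>n. coeff (\<psi> m) n * a m) = 0" for a
  proof -
    have "P a = 0"
      using P_eq[OF that(1)] that(2) by (simp add: coeff_P_n)
    then have sum: "(\<Sum>m\<le>n. a m * coeff (\<psi> m) i) = 0" for i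
      using coeff_P[of a i] by simp
    show ?thesis
      using triangular_sum_eq_0[OF biorthogonal_coeff_eq_0(2)[OF weight system]
          biorthogonal_lead_coeff_ne_0(2)[OF weight system] sum] by blast
  qed
  have cont: "continuous_on (sphere 0 1) (g m)" for m
    unfolding g_def by (intro continuous_intros) auto
  have entries: "\<beta> r powi (- int m) * assoc_fun_star w \<psi> m (\<beta> r)
      = \<beta> r * cauchy_transform (\<lambda>\<zeta>. w \<zeta> * g m \<zeta>) (\<beta> r)" if "r \<in> {1..L}" for r m
    using \<beta>[OF that] assoc_fun_star_eq_cauchy_transform[OF weight system off[OF that], of m]
    by (simp add: g_def power_int_minus)
  \<comment> \<open>The power columns carry the same factor \<open>\<beta> r\<close> that
    \<open>z ^ Suc m\<close> leaves in the associated functions, hence the choice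
    \<open>\<sigma> = \<beta>\<close>.\<close>
  have powers: "\<beta> r ^ (L - n - j) = \<beta> r * \<beta> r ^ (L - n - 1 - j)" if "j < L - n" for r j
    using that by (simp flip: power_Suc add: Suc_diff_Suc)
  obtain b a where
    D: "\<And>p f. D p f = (\<Sum>j<L - n. p j * b j) + (\<Sum>m\<le>n. f m * a m)"
    and t: "(\<Sum>m\<le>n. coeff (\<psi> m) n * a m) \<noteq> 0"
    and orth: "\<And>k. k < n \<Longrightarrow>
      circle_int (\<lambda>\<zeta>. modified_weight w L \<beta> \<zeta> * (\<Sum>m\<le>n. a m * g m \<zeta>) * \<zeta> ^ k) = 0"
    and interpolation: "\<And>z. z \<notin> sphere 0 1 \<Longrightarrow> (\<Sum>j<L - n. z ^ (L - n - 1 - j) * b j)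
        + (\<Sum>m\<le>n. cauchy_transform (\<lambda>\<zeta>. w \<zeta> * g m \<zeta>) z * a m)
      = (\<Prod>j=1..L. z - \<beta> j) * cauchy_transform (\<lambda>\<zeta>. modified_weight w L \<beta> \<zeta> * (\<Sum>m\<le>n. a m * g m \<zeta>)) z"
    unfolding D_def
    by (rule bordered_det_interpolation[OF weight inj off \<open>n < L\<close> cont, where \<sigma> = \<beta>
          and q = "\<lambda>r j. \<beta> r ^ (L - n - j)" and t = "\<lambda>m. coeff (\<psi> m) n"
          and h = "\<lambda>r m. \<beta> r powi (- int m) * assoc_fun_star w \<psi> m (\<beta> r)"])
      (use \<beta> powers entries trivial in auto)
  define c where "c = coeff (P a) n / coeff (\<Psi> n) n"
  have lead: "coeff (\<Psi> n) n \<noteq> 0"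
    by (rule biorthogonal_lead_coeff_ne_0(2)[OF weight' system'])
  have "c \<noteq> 0"
    using t lead by (simp add: c_def coeff_P_n)
  have P: "P a = Polynomial.smult c (\<Psi> n)"
    unfolding c_def by (rule P_eq[OF orth])
  show ?thesis
  proof (intro exI[of _ "1 / c"] conjI allI impI)
    fix z
    have "(\<Sum>m\<le>n. z ^ (n - m) * poly (recip \<psi> m) z * a m) = c * poly (recip \<Psi> n) z"
    \<comment> \<open>The expression through \<open>1 / z\<close> fails at 0. There
      \<open>0 ^ (n - m)\<close> leaves only \<open>m = n\<close>, and the reciprocal polynomial
      takes the leading coefficient of \<open>\<psi> n\<close> as its value.\<close>
    proof (cases "z = 0")
      case True
      have "(\<Sum>m\<le>n. z ^ (n - m) * poly (recip \<psi> m) z * a m) = (\<Sum>m\<le>n. a m * coeff (\<psi> m) n)"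
      proof (intro sum.cong refl)
        fix m assume "m \<in> {..n}"
        then show "z ^ (n - m) * poly (recip \<psi> m) z * a m = a m * coeff (\<psi> m) n"
          using biorthogonal_coeff_eq_0(2)[OF weight system, of m n]
            biorthogonal_degree(2)[OF weight system, of m] True
          by (cases "m = n") (auto simp: recip_def)
      qed
      also have "\<dots> = c * coeff (\<Psi> n) n"
        using lead by (simp add: c_def coeff_P)
      finally show ?thesis
        using True biorthogonal_degree(2)[OF weight' system', of n] by (simp add: recip_def)
    next
      case False
      have "(\<Sum>m\<le>n. z ^ (n - m) * poly (recip \<psi> m) z * a m) = z ^ n * poly (P a) (1 / z)"
        unfolding P_def poly_sum sum_distrib_left using False
        by (intro sum.cong)
          (auto simp: poly_recip biorthogonal_degree(2)[OF weight system] power_diff)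
      then show ?thesis
        using False by (simp add: P poly_recip biorthogonal_degree(2)[OF weight' system'])
    qed
    then show "poly (recip \<Psi> n) z = 1 / c * D (\<lambda>j. 0) (\<lambda>m. z ^ (n - m) * poly (recip \<psi> m) z)"
      using \<open>c \<noteq> 0\<close> by (simp add: D)
  next
    fix z :: complex assume z: "z \<notin> sphere 0 1"
    \<comment> \<open>The top row now starts one power higher, so its common factor is
      \<open>z ^ Suc n\<close>.\<close>
    have "D (\<lambda>j. z ^ (L - j)) (\<lambda>m. z ^ (n - m) * assoc_fun_star w \<psi> m z)
        = (\<Sum>j<L - n. z ^ Suc n * (z ^ (L - n - 1 - j) * b j))
          + (\<Sum>m\<le>n. z ^ Suc n * (cauchy_transform (\<lambda>\<zeta>. w \<zeta> * g m \<zeta>) z * a m))"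
      unfolding D
    proof (intro arg_cong2[where f = "(+)"] sum.cong refl)
      fix j assume "j \<in> {..<L - n}"
      then have "L - j = Suc n + (L - n - 1 - j)" by auto
      then show "z ^ (L - j) * b j = z ^ Suc n * (z ^ (L - n - 1 - j) * b j)"
        by (simp only: power_add mult.assoc)
    next
      fix m assume "m \<in> {..n}"
      then have pow: "z ^ Suc n = z ^ (n - m) * z ^ Suc m"
        by (simp flip: power_add)
      show "z ^ (n - m) * assoc_fun_star w \<psi> m z * a m
          = z ^ Suc n * (cauchy_transform (\<lambda>\<zeta>. w \<zeta> * g m \<zeta>) z * a m)"
        unfolding assoc_fun_star_eq_cauchy_transform[OF weight system z] g_def pow by (simp only: mult_ac)
    qed
    also have "\<dots> = z ^ Suc n * ((\<Prod>j=1..L. z - \<beta> j)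
        * cauchy_transform (\<lambda>\<zeta>. modified_weight w L \<beta> \<zeta> * (\<Sum>m\<le>n. a m * g m \<zeta>)) z)"
      unfolding interpolation[OF z, symmetric] by (simp add: sum_distrib_left distrib_left)
    also have "(\<lambda>\<zeta>. modified_weight w L \<beta> \<zeta> * (\<Sum>m\<le>n. a m * g m \<zeta>))
        = (\<lambda>\<zeta>. c * (modified_weight w L \<beta> \<zeta> * (- 2 * poly (\<Psi> n) (1 / \<zeta>))))"
      unfolding sum_g P by (simp add: mult_ac)
    finally show "(\<Prod>j=1..L. z - \<beta> j) * assoc_fun_star (modified_weight w L \<beta>) \<Psi> n z
        = 1 / c * D (\<lambda>j. z ^ (L - j)) (\<lambda>m. z ^ (n - m) * assoc_fun_star w \<psi> m z)"
      unfolding cauchy_transform_cmult assoc_fun_star_eq_cauchy_transform[OF weight' system' z]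
      using \<open>c \<noteq> 0\<close> by simp
  qed
qed

theorem proposition3p3:
  fixes w :: "complex \<Rightarrow> complex" and L n :: nat and \<beta> :: "nat \<Rightarrow> complex"
    and \<phi> \<psi> \<Phi> \<Psi> :: "nat \<Rightarrow> complex poly"
  assumes "circle_weight w"
    and "L \<ge> 1" and "n < L"
    and "inj_on \<beta> {1..L}"
    and "\<And>j. j \<in> {1..L} \<Longrightarrow> \<beta> j \<noteq> 0 \<and> \<beta> j \<notin> sphere 0 1"
    and "biorthogonal_system w \<phi> \<psi>" and "generic_system \<phi> \<psi>"
    and "biorthogonal_system (modified_weight w L \<beta>) \<Phi> \<Psi>" and "generic_system \<Phi> \<Psi>"
  shows "\<exists>C Cs.
    (\<forall>z. poly (\<Phi> n) z = C * bordered_det L n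
       (\<lambda>j. 0) (\<lambda>m. z ^ (n - m) * poly (\<phi> m) z)
       (\<lambda>r j. \<beta> r ^ (L - n - 1 - j)) (\<lambda>r m. \<beta> r powi (- int m) * assoc_fun w \<phi> m (\<beta> r))) \<and>
    (\<forall>z. poly (recip \<Psi> n) z = Cs * bordered_det L n
       (\<lambda>j. 0) (\<lambda>m. z ^ (n - m) * poly (recip \<psi> m) z)
       (\<lambda>r j. \<beta> r ^ (L - n - j)) (\<lambda>r m. \<beta> r powi (- int m) * assoc_fun_star w \<psi> m (\<beta> r))) \<and>
    (\<forall>z. z \<notin> sphere 0 1 \<longrightarrow>
       (\<Prod>j=1..L. z - \<beta> j) * assoc_fun (modified_weight w L \<beta>) \<Phi> n z = C * bordered_det L n
       (\<lambda>j. z ^ (L - 1 - j)) (\<lambda>m. z ^ (n - m) * assoc_fun w \<phi> m z)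
       (\<lambda>r j. \<beta> r ^ (L - n - 1 - j)) (\<lambda>r m. \<beta> r powi (- int m) * assoc_fun w \<phi> m (\<beta> r))) \<and>
    (\<forall>z. z \<notin> sphere 0 1 \<longrightarrow>
       (\<Prod>j=1..L. z - \<beta> j) * assoc_fun_star (modified_weight w L \<beta>) \<Psi> n z = Cs * bordered_det L n
       (\<lambda>j. z ^ (L - j)) (\<lambda>m. z ^ (n - m) * assoc_fun_star w \<psi> m z)
       (\<lambda>r j. \<beta> r ^ (L - n - j)) (\<lambda>r m. \<beta> r powi (- int m) * assoc_fun_star w \<psi> m (\<beta> r)))"
proof -
  \<comment> \<open>Genericity starts at index 1; for \<open>m = 0\<close> the polynomial is a
    nonzero constant.\<close>
  have nonzero: "poly (\<phi> m) 0 \<noteq> 0" for m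
  proof (cases "m = 0")
    case True
    then show ?thesis
      using biorthogonal_lead_coeff_ne_0(1)[OF assms(1,6), of 0] by (simp add: poly_0_coeff_0)
  next
    case False
    then show ?thesis
      using assms(7) unfolding generic_system_def reflection_coeff_def
      by (metis One_nat_def Suc_leI div_0 gr0I mult_zero_left)
  qed
  \<comment> \<open>A polynomial and its associated function share one constant; the regrouping
    gives the interleaved order of the four formulas.\<close>
  have combine: "\<exists>C. P C \<and> R C \<Longrightarrow> \<exists>Cs. Q Cs \<and> S Cs \<Longrightarrow> \<exists>C Cs. P C \<and> Q Cs \<and> R C \<and> S Cs"
    for P Q R S :: "complex \<Rightarrow> bool"
    by blast
  show ?thesis
    by (rule combine[OF bordered_det_assoc_fun bordered_det_assoc_fun_star])
      (rule assms nonzero; assumption?)+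
qed

end
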